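(* Let $\mathcal{M}$ be a reflexive quantum metric space. Suppose that $\mathcal{N}_1$ and $\mathcal{N}_2$ are metric quotients of $\mathcal{M}$, corresponding to central projections $R_1$ and $R_2$ of $\mathcal{M}$, respectively. If $R_1 \vee R_2 = \mathrm{Id}$, then \[\operatorname{asdim}(\mathcal{M}) \le \max \{ \operatorname{asdim}(\mathcal{N}_1), \operatorname{asdim}(\mathcal{N}_2) \}.\]
   Context: Von Neumann algebras are concrete: $\mathcal{M}\subseteq\mathcal{B}(\mathcal{H})$, with commutant $\mathcal{M}'$; "projection" means orthogonal projection; $\mathcal{M}\overline{\otimes}\mathcal{B}(\ell_2)$ is the weak*-closed spatial tensor product in $\mathcal{B}(\mathcal{H}\otimes_2\ell_2)$. $\inf\emptyset=\infty$. A quantum metric on $\mathcal{M}\subseteq \mathcal{B}(\mathcal{H})$ is a family $\mathbb{V}=\{\mathcal{V}_t\}_{t\in[0,\infty)}$ of weak*-closed self-adjoint subspaces of $\mathcal{B}(\mathcal{H})$ with $\mathcal{V}_0=\mathcal{M}'$, $\mathcal{V}_s\mathcal{V}_t\subseteq \mathcal{V}_{s+t}$ for all $s,t\ge 0$, and $\mathcal{V}_t=\bigcap_{s>t}\mathcal{V}_s$ for all $t\ge0$. A quantum metric space is a pair $(\mathcal{M},\mathbb{V})$. A subspace $\mathcal{V}\subseteq\mathcal{B}(\mathcal{H})$ is reflexive if $\mathcal{V}=\{B\in\mathcal{B}(\mathcal{H})\mid P\mathcal{V}Q=\{0\}\Rightarrow PBQ=0\}$, with $P,Q$ ranging over projections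 in $\mathcal{B}(\mathcal{H})$; the quantum metric (space) is reflexive if every $\mathcal{V}_t$ is reflexive. For projections $P,Q\in\mathcal{M}\overline{\otimes}\mathcal{B}(\ell_2)$, $\operatorname{dist}(P,Q)=\inf\{t \mid P(A\otimes \mathrm{Id})Q\ne0 \text{ for some } A\in\mathcal{V}_t\}$; for $P,Q\in\mathcal{M}$ (identified with $P\otimes\mathrm{Id}$, $Q\otimes \mathrm{Id}$) this is $\inf\{t\mid PAQ\neq0\text{ for some }A\in\mathcal{V}_t\}$. For a nonzero projection $P\in\mathcal{M}$, $\operatorname{diam}(P)=\sup\{\operatorname{dist}(Q,R)\mid Q(PAP\otimes\mathrm{Id})R\ne0\text{ for some }A\in\mathcal{B}(\mathcal{H})\}$, with $Q,R$ ranging over projections in $\mathcal{M}\overline{\otimes}\mathcal{B}(\ell_2)$; $\operatorname{diam}(0)=0$. The open $\varepsilon$-neighborhood of a projection $P\in\mathcal{M}$ is $(P)_\varepsilon=\mathrm{Id}-\bigvee\{Q\in\mathcal{M}\text{ projection}\mid \operatorname{dist}(P,Q)\ge\varepsilon\}$. A family $\mathscr{P}$ of projections in $\mathcal{M}$ is a cover if $\bigvee_{P\in\mathscr{P}}P=\mathrm{Id}$; it is $r$-disjoint if $(P)_r(Q)_r=0$ for all distinct $P,Q\in\mathscr{P}$; it is uniformly bounded if $\sup_{P\in\mathscr{P}}\operatorname{diam}(P)\le R$ for some $R>0$. $\operatorname{asdim}(\mathcal{M})\le n$ ($n\in\mathbb{N}\cup\{0\}$) if for every $r>0$ there are uniformly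 bounded, $r$-disjoint families $\mathscr{P}^0,\dots,\mathscr{P}^n$ of projections in $\mathcal{M}$ whose union is a cover for $\mathcal{M}$; $\operatorname{asdim}(\mathcal{M})$ is the least such $n$, and $\infty$ if there is none. Metric quotient: given $(\mathcal{M},\{\mathcal{V}_t\})$ with $\mathcal{M}\subseteq\mathcal{B}(\mathcal{H})$ and a central projection $R\in\mathcal{M}$, the corresponding metric quotient is the direct summand $R\mathcal{M}\subseteq\mathcal{B}(R\mathcal{H})$ with the quantum metric $\{R\mathcal{V}_tR\}_{t\ge0}$ (compressions viewed as operators on $R\mathcal{H}$). (The case where $\mathcal{M}=\mathcal{N}_1\oplus\mathcal{N}_2$ is included.) *)

theory Defs
  imports "HOL-Analysis.Analysis" "HOL-Library.Extended_Nat"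
begin

section \<open>Complex Hilbert spaces\<close>

class complex_vector = real_vector +
  fixes scaleC :: "complex \<Rightarrow> 'a \<Rightarrow> 'a"  (infixr \<open>*\<^sub>C\<close> 75)
  assumes scaleC_add_right: "c *\<^sub>C (x + y) = c *\<^sub>C x + c *\<^sub>C y"
    and scaleC_add_left: "(c + d) *\<^sub>C x = c *\<^sub>C x + d *\<^sub>C x"
    and scaleC_scaleC: "c *\<^sub>C d *\<^sub>C x = (c * d) *\<^sub>C x"
    and scaleR_eq_scaleC: "r *\<^sub>R x = complex_of_real r *\<^sub>C x"

lemma scaleC_one: "1 *\<^sub>C (x::'a::complex_vector) = x"
  using scaleR_eq_scaleC[of 1 x] by simp

global_interpretation complex_vector: vector_space "scaleC :: complex \<Rightarrow> 'a \<Rightarrow> 'a::complex_vector"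
  defines csubspace = complex_vector.subspace
    and cspan = complex_vector.span
  by unfold_locales (simp_all add: scaleC_add_right scaleC_add_left scaleC_scaleC scaleC_one)

text \<open>The complex inner product is linear in its first argument; its real part is the
  library's real inner product, so that norm, metric and topology are those of the library.\<close>

class complex_hilbert = complex_vector + real_inner + complete_space +
  fixes cinner :: "'a \<Rightarrow> 'a \<Rightarrow> complex"
  assumes cinner_add_left: "cinner (x + y) z = cinner x z + cinner y z"
    and cinner_scaleC_left: "cinner (c *\<^sub>C x) y = c * cinner x y"
    and cinner_commute: "cinner x y = cnj (cinner y x)"
    and Re_cinner: "Re (cinner x y) = inner x y"
begin

subclass banach ..

end

lemma norm_scaleC: "norm (c *\<^sub>C x) = cmod c * norm (x::'a::complex_hilbert)"
proof -
  have "cinner (c *\<^sub>C x) (c *\<^sub>C x) = c * cnj (c * cinner x x)"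
    by (metis cinner_scaleC_left cinner_commute)
  also have "\<dots> = complex_of_real ((cmod c)\<^sup>2) * cinner x x"
    by (metis (no_types, lifting) cinner_commute complex_cnj_mult complex_norm_square mult.assoc)
  finally have "Re (cinner (c *\<^sub>C x) (c *\<^sub>C x)) = (cmod c)\<^sup>2 * Re (cinner x x)"
    by simp
  then have "(norm (c *\<^sub>C x))\<^sup>2 = (cmod c * norm x)\<^sup>2"
    by (simp add: Re_cinner power_mult_distrib power2_norm_eq_inner)
  then show ?thesis
    by (simp add: power2_eq_iff_nonneg)
qed

lemma norm_cinner_le: "cmod (cinner x y) \<le> norm x * norm (y::'a::complex_hilbert)"
proof (cases "cinner x y = 0")
  case False
  define c where "c = cnj (cinner x y) / cmod (cinner x y)"
  have c: "cmod c = 1"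
    using False by (simp add: c_def norm_divide)
  have "cinner (c *\<^sub>C x) y = complex_of_real (cmod (cinner x y))"
    using False complex_norm_square[of "cinner x y"]
    by (simp add: cinner_scaleC_left c_def field_simps power2_eq_square)
  then have "cmod (cinner x y) = inner (c *\<^sub>C x) y"
    by (simp flip: Re_cinner)
  also have "\<dots> \<le> norm (c *\<^sub>C x) * norm y"
    by (rule norm_cauchy_schwarz)
  finally show ?thesis
    by (simp add: norm_scaleC c)
qed simp

instantiation complex :: complex_hilbert
begin

definition scaleC_complex_def: "c *\<^sub>C x = c * (x::complex)"
definition cinner_complex_def: "cinner x y = x * cnj (y::complex)"

instance
  by standard
    (simp_all add: scaleC_complex_def cinner_complex_def inner_complex_def algebra_simps
      scaleR_conv_of_real)

end


section \<open>The Hilbert space tensor product of H with the sequence space l2\<close>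

text \<open>H tensor l2 is realised as the space of square-summable sequences in H; the
  elementary tensor of x and s is the sequence of the s(n) x. The space l2 itself
  is \<open>complex ell2\<close>.\<close>

typedef (overloaded) ('a::complex_hilbert) ell2 =
    "{x :: nat \<Rightarrow> 'a. summable (\<lambda>n. (norm (x n))\<^sup>2)}"
  morphisms ell2_nth Abs_ell2
  by (rule exI[of _ "\<lambda>_. 0"]) simp

setup_lifting type_definition_ell2

lemma summable_norm_sq_add:
  fixes x y :: "nat \<Rightarrow> 'a::real_normed_vector"
  assumes "summable (\<lambda>n. (norm (x n))\<^sup>2)" "summable (\<lambda>n. (norm (y n))\<^sup>2)"
  shows "summable (\<lambda>n. (norm (x n + y n))\<^sup>2)"
proof (rule summable_comparison_test')
  show "summable (\<lambda>n. 2 * (norm (x n))\<^sup>2 + 2 * (norm (y n))\<^sup>2)"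
    using assms by (intro summable_add summable_mult)
  fix n
  have "(norm (x n + y n))\<^sup>2 \<le> (norm (x n) + norm (y n))\<^sup>2"
    by (simp add: norm_triangle_ineq power_mono)
  also have "\<dots> \<le> 2 * (norm (x n))\<^sup>2 + 2 * (norm (y n))\<^sup>2"
    using zero_le_power2[of "norm (x n) - norm (y n)"]
    unfolding power2_sum power2_diff by linarith
  finally show "norm ((norm (x n + y n))\<^sup>2) \<le> 2 * (norm (x n))\<^sup>2 + 2 * (norm (y n))\<^sup>2"
    by simp
qed

lemma summable_norm_mult:
  fixes x y :: "nat \<Rightarrow> 'a::real_normed_vector"
  assumes "summable (\<lambda>n. (norm (x n))\<^sup>2)" "summable (\<lambda>n. (norm (y n))\<^sup>2)"
  shows "summable (\<lambda>n. norm (x n) * norm (y n))"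
proof (rule summable_comparison_test')
  show "summable (\<lambda>n. (norm (x n))\<^sup>2 + (norm (y n))\<^sup>2)"
    using assms by (intro summable_add)
  fix n
  show "norm (norm (x n) * norm (y n)) \<le> (norm (x n))\<^sup>2 + (norm (y n))\<^sup>2"
    using sum_squares_bound[of "norm (x n)" "norm (y n)"]
      mult_nonneg_nonneg[OF norm_ge_zero[of "x n"] norm_ge_zero[of "y n"]]
    unfolding real_norm_def abs_mult abs_norm_cancel mult.assoc by linarith
qed

lemma summable_ell2_norm: "summable (\<lambda>n. (norm (ell2_nth x n))\<^sup>2)"
  using ell2_nth by blast

lemma summable_ell2_inner: "summable (\<lambda>n. inner (ell2_nth x n) (ell2_nth y n))"
  by (rule summable_comparison_test'
      [OF summable_norm_mult[OF summable_ell2_norm[of x] summable_ell2_norm[of y]]])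
    (simp add: Cauchy_Schwarz_ineq2)

lemma summable_ell2_cinner: "summable (\<lambda>n. cinner (ell2_nth x n) (ell2_nth y n))"
  by (rule summable_comparison_test'
      [OF summable_norm_mult[OF summable_ell2_norm[of x] summable_ell2_norm[of y]]])
    (simp add: norm_cinner_le)

instantiation ell2 :: (complex_hilbert) complex_vector
begin

lift_definition zero_ell2 :: "'a ell2" is "\<lambda>_. 0" by simp
lift_definition plus_ell2 :: "'a ell2 \<Rightarrow> 'a ell2 \<Rightarrow> 'a ell2" is "\<lambda>x y n. x n + y n"
  by (rule summable_norm_sq_add)
lift_definition uminus_ell2 :: "'a ell2 \<Rightarrow> 'a ell2" is "\<lambda>x n. - x n" by simp
lift_definition minus_ell2 :: "'a ell2 \<Rightarrow> 'a ell2 \<Rightarrow> 'a ell2" is "\<lambda>x y n. x n - y n"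
  using summable_norm_sq_add[of _ "\<lambda>n. - _ n"] by fastforce
lift_definition scaleR_ell2 :: "real \<Rightarrow> 'a ell2 \<Rightarrow> 'a ell2" is "\<lambda>r x n. r *\<^sub>R x n"
  by (simp add: power_mult_distrib summable_mult)
lift_definition scaleC_ell2 :: "complex \<Rightarrow> 'a ell2 \<Rightarrow> 'a ell2" is "\<lambda>c x n. c *\<^sub>C x n"
  by (simp add: norm_scaleC power_mult_distrib summable_mult)

instance
  by (standard; transfer)
    (simp_all add: fun_eq_iff algebra_simps scaleC_add_right scaleC_add_left scaleC_scaleC
      scaleR_eq_scaleC scaleC_one)

end

lemmas ell2_nth_simps [simp] =
  zero_ell2.rep_eq plus_ell2.rep_eq uminus_ell2.rep_eq minus_ell2.rep_eq
  scaleR_ell2.rep_eq scaleC_ell2.rep_eq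

instantiation ell2 :: (complex_hilbert) real_inner
begin

definition inner_ell2_def: "inner x y = (\<Sum>n. inner (ell2_nth x n) (ell2_nth y n))"
definition norm_ell2_def: "norm x = sqrt (inner x (x::'a ell2))"
definition sgn_ell2_def: "sgn x = inverse (norm x) *\<^sub>R (x::'a ell2)"
definition dist_ell2_def: "dist x y = norm (x - (y::'a ell2))"
definition uniformity_ell2_def:
  "(uniformity :: ('a ell2 \<times> 'a ell2) filter) = (INF e\<in>{0 <..}. principal {(x, y). dist x y < e})"
definition open_ell2_def:
  "open (U :: 'a ell2 set) \<longleftrightarrow> (\<forall>x\<in>U. eventually (\<lambda>(x', y). x' = x \<longrightarrow> y \<in> U) uniformity)"

instance
proof
  fix x y z :: "'a ell2" and r :: real
  show "inner x y = inner y x"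
    by (simp add: inner_ell2_def inner_commute)
  show "inner (x + y) z = inner x z + inner y z"
    by (simp add: inner_ell2_def inner_add_left suminf_add summable_ell2_inner)
  show "inner (r *\<^sub>R x) y = r * inner x y"
    by (simp add: inner_ell2_def suminf_mult summable_ell2_inner)
  show "0 \<le> inner x x"
    by (simp add: inner_ell2_def suminf_nonneg summable_ell2_inner)
  show "inner x x = 0 \<longleftrightarrow> x = 0"
    unfolding inner_ell2_def
    by (subst suminf_eq_zero_iff) (auto simp: summable_ell2_inner fun_eq_iff
        simp flip: ell2_nth_inject)
qed (simp_all add: norm_ell2_def sgn_ell2_def dist_ell2_def uniformity_ell2_def open_ell2_def)

end

lemma norm_ell2_sq: "(norm (x::'a::complex_hilbert ell2))\<^sup>2 = (\<Sum>n. (norm (ell2_nth x n))\<^sup>2)"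
  by (simp add: power2_norm_eq_inner inner_ell2_def)

lemma norm_ell2_nth_le: "norm (ell2_nth x n) \<le> norm x"
proof -
  have "(\<Sum>k\<in>{n}. (norm (ell2_nth x k))\<^sup>2) \<le> (\<Sum>k. (norm (ell2_nth x k))\<^sup>2)"
    by (rule sum_le_suminf) (auto simp: summable_ell2_norm)
  then show ?thesis
    by (simp flip: norm_ell2_sq)
qed

instance ell2 :: (complex_hilbert) complete_space
proof
  fix X :: "nat \<Rightarrow> 'a ell2"
  assume X: "Cauchy X"
  have "Cauchy (\<lambda>m. ell2_nth (X m) n)" for n
  proof (rule metric_CauchyI)
    fix e :: real assume "0 < e"
    then obtain N where N: "\<And>m k. m \<ge> N \<Longrightarrow> k \<ge> N \<Longrightarrow> dist (X m) (X k) < e"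
      using metric_CauchyD[OF X] by blast
    have "dist (ell2_nth (X m) n) (ell2_nth (X k) n) \<le> dist (X m) (X k)" for m k
      using norm_ell2_nth_le[of "X m - X k" n] by (simp add: dist_norm)
    then show "\<exists>N. \<forall>m\<ge>N. \<forall>k\<ge>N. dist (ell2_nth (X m) n) (ell2_nth (X k) n) < e"
      using N by (meson le_less_trans)
  qed
  then have "\<exists>l. (\<lambda>m. ell2_nth (X m) n) \<longlonglongrightarrow> l" for n
    by (simp add: Cauchy_convergent_iff convergent_def)
  then obtain L where L: "\<And>n. (\<lambda>m. ell2_nth (X m) n) \<longlonglongrightarrow> L n"
    by metis
  have bound: "summable (\<lambda>n. (norm (ell2_nth (X m) n - L n))\<^sup>2) \<and>
      (\<Sum>n. (norm (ell2_nth (X m) n - L n))\<^sup>2) \<le> e\<^sup>2"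
    if "0 < e" and N: "\<And>m k. m \<ge> N \<Longrightarrow> k \<ge> N \<Longrightarrow> dist (X m) (X k) < e" and "m \<ge> N"
    for e :: real and N m
  proof -
    have *: "(\<Sum>n<j. (norm (ell2_nth (X m) n - L n))\<^sup>2) \<le> e\<^sup>2" for j
    proof (rule LIMSEQ_le_const2)
      show "(\<lambda>k. \<Sum>n<j. (norm (ell2_nth (X m) n - ell2_nth (X k) n))\<^sup>2)
          \<longlonglongrightarrow> (\<Sum>n<j. (norm (ell2_nth (X m) n - L n))\<^sup>2)"
        by (intro tendsto_intros L)
      have "(\<Sum>n<j. (norm (ell2_nth (X m) n - ell2_nth (X k) n))\<^sup>2) \<le> e\<^sup>2" if "k \<ge> N" for k
      proof -
        have "(\<Sum>n<j. (norm (ell2_nth (X m - X k) n))\<^sup>2) \<le> (norm (X m - X k))\<^sup>2"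
          unfolding norm_ell2_sq
            by (rule sum_le_suminf) (auto simp del: ell2_nth_simps simp: summable_ell2_norm)
        also have "\<dots> \<le> e\<^sup>2"
          using N[OF \<open>m \<ge> N\<close> that] by (intro power_mono) (auto simp: dist_norm)
        finally show ?thesis by simp
      qed
      then show "\<exists>N. \<forall>k\<ge>N. (\<Sum>n<j. (norm (ell2_nth (X m) n - ell2_nth (X k) n))\<^sup>2) \<le> e\<^sup>2"
        by blast
    qed
    have "summable (\<lambda>n. (norm (ell2_nth (X m) n - L n))\<^sup>2)"
      by (rule summableI_nonneg_bounded[OF _ *]) simp
    then show ?thesis
      using * by (simp add: suminf_le_const)
  qed
  obtain N1 where "\<And>m k. m \<ge> N1 \<Longrightarrow> k \<ge> N1 \<Longrightarrow> dist (X m) (X k) < 1"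
    using metric_CauchyD[OF X zero_less_one] by blast
  then have "summable (\<lambda>n. (norm (ell2_nth (X N1) n - L n))\<^sup>2)"
    using bound[of 1 N1 N1] by simp
  then have "summable (\<lambda>n. (norm (- (ell2_nth (X N1) n - L n) + ell2_nth (X N1) n))\<^sup>2)"
    by (intro summable_norm_sq_add summable_ell2_norm) (simp add: norm_minus_commute)
  then have L_nth: "ell2_nth (Abs_ell2 L) = L"
    by (simp add: Abs_ell2_inverse)
  have "X \<longlonglongrightarrow> Abs_ell2 L"
  proof (rule metric_LIMSEQ_I)
    fix e :: real assume "0 < e"
    then obtain N where N: "\<And>m k. m \<ge> N \<Longrightarrow> k \<ge> N \<Longrightarrow> dist (X m) (X k) < e / 2"
      using metric_CauchyD[OF X, of "e / 2"] by auto
    have "dist (X m) (Abs_ell2 L) < e" if "m \<ge> N" for m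
    proof -
      have "(norm (X m - Abs_ell2 L))\<^sup>2 \<le> (e / 2)\<^sup>2"
        using bound[of "e / 2" N m] \<open>0 < e\<close> N that by (simp add: norm_ell2_sq L_nth)
      then have "norm (X m - Abs_ell2 L) \<le> e / 2"
        using \<open>0 < e\<close> by (simp add: power2_le_iff_abs_le)
      then show ?thesis
        using \<open>0 < e\<close> by (simp add: dist_norm)
    qed
    then show "\<exists>N. \<forall>m\<ge>N. dist (X m) (Abs_ell2 L) < e"
      by blast
  qed
  then show "convergent X"
    by (auto simp: convergent_def)
qed

instantiation ell2 :: (complex_hilbert) complex_hilbert
begin

definition cinner_ell2_def: "cinner x y = (\<Sum>n. cinner (ell2_nth x n) (ell2_nth y n))"

instance
proof
  fix x y z :: "'a ell2" and c :: complex
  show "cinner (x + y) z = cinner x z + cinner y z"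
    by (simp add: cinner_ell2_def cinner_add_left suminf_add summable_ell2_cinner)
  show "cinner (c *\<^sub>C x) y = c * cinner x y"
    by (simp add: cinner_ell2_def cinner_scaleC_left suminf_mult summable_ell2_cinner)
  have "(\<lambda>n. cnj (cinner (ell2_nth y n) (ell2_nth x n))) sums cnj (cinner y x)"
    unfolding cinner_ell2_def sums_cnj by (rule summable_sums[OF summable_ell2_cinner])
  then show "cinner x y = cnj (cinner y x)"
    unfolding cinner_ell2_def by (subst (asm) cinner_commute[symmetric]) (simp add: sums_iff)
  show "Re (cinner x y) = inner x y"
    by (simp add: cinner_ell2_def inner_ell2_def Re_suminf summable_ell2_cinner Re_cinner)
qed

end

lift_definition tensor_vec :: "'a::complex_hilbert \<Rightarrow> complex ell2 \<Rightarrow> 'a ell2"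
  is "\<lambda>x s n. s n *\<^sub>C x"
  by (simp add: norm_scaleC power_mult_distrib summable_mult2)


section \<open>Operators\<close>

text \<open>Bounded operators on H are the complex-linear elements of the library type of bounded
  real-linear maps. Further Hilbert spaces arise as closed subspaces K of H; a bounded operator
  on K is represented by its extension by 0 on the orthogonal complement of K,
  so B(K) is the following corner of B(H), with unit \<open>proj_onto K\<close> (defined below).
  In this way the compression of A to the range of a projection R is R A R.\<close>

definition operators_on :: "'a::complex_hilbert set \<Rightarrow> ('a \<Rightarrow>\<^sub>L 'a) set" where
  "operators_on K = {A :: 'a \<Rightarrow>\<^sub>L 'a. (\<forall>c x. A (c *\<^sub>C x) = c *\<^sub>C A x) \<and> (\<forall>x. A x \<in> K) \<and>
     (\<forall>x. (\<forall>y\<in>K. cinner x y = 0) \<longrightarrow> A x = 0)}"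

instantiation blinfun :: (real_normed_vector, complex_hilbert) complex_vector
begin

lift_definition scaleC_blinfun :: "complex \<Rightarrow> ('a \<Rightarrow>\<^sub>L 'b) \<Rightarrow> 'a \<Rightarrow>\<^sub>L 'b" is "\<lambda>c f x. c *\<^sub>C f x"
proof -
  fix c :: complex and f :: "'a \<Rightarrow> 'b"
  assume f: "bounded_linear f"
  have "bounded_linear (\<lambda>x::'b. c *\<^sub>C x)"
    by (rule bounded_linear_intro[where K = "cmod c"])
      (simp_all add: scaleC_add_right scaleR_eq_scaleC scaleC_scaleC norm_scaleC mult.commute)
  then show "bounded_linear (\<lambda>x. c *\<^sub>C f x)"
    using f by (rule bounded_linear_compose)
qed

instance
  by (standard; transfer)
    (simp_all add: fun_eq_iff scaleC_add_right scaleC_add_left scaleC_scaleC scaleR_eq_scaleC)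

end

definition adj :: "('a::complex_hilbert \<Rightarrow>\<^sub>L 'a) \<Rightarrow> 'a \<Rightarrow>\<^sub>L 'a" where
  "adj A = (THE B :: 'a \<Rightarrow>\<^sub>L 'a. \<forall>x y. cinner (A x) y = cinner x (B y))"

definition projections :: "('a::complex_hilbert \<Rightarrow>\<^sub>L 'a) set \<Rightarrow> ('a \<Rightarrow>\<^sub>L 'a) set" where
  "projections S = {P :: 'a \<Rightarrow>\<^sub>L 'a. P \<in> S \<and> P \<in> operators_on UNIV \<and>
     P o\<^sub>L P = P \<and>
     (\<forall>x y. cinner (P x) y = cinner x (P y))}"

definition proj_onto :: "'a::complex_hilbert set \<Rightarrow> 'a \<Rightarrow>\<^sub>L 'a" where
  "proj_onto K = (THE P :: 'a \<Rightarrow>\<^sub>L 'a. P \<in> projections UNIV \<and> range P = K)"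

definition proj_join :: "('a::complex_hilbert \<Rightarrow>\<^sub>L 'a) set \<Rightarrow> 'a \<Rightarrow>\<^sub>L 'a" where
  "proj_join S = proj_onto (closure (cspan (\<Union>P\<in>S. range (blinfun_apply P))))"

text \<open>The weak* topology of B(H) as the dual of the trace class operators. Every trace class
  operator has the form sum over n of the rank-one operators given by x(n) and y(n)
  with square-summable sequences x and y in H, so this is the initial topology for
  the functionals below. It restricts to the weak* topology on each B(K), which is weak*-closed
  in B(H).\<close>

definition weakstar_topology :: "('a::complex_hilbert \<Rightarrow>\<^sub>L 'a) topology" where
  "weakstar_topology = pullback_topology (operators_on UNIV)
     (\<lambda>(A :: 'a \<Rightarrow>\<^sub>L 'a) (x :: 'a ell2, y :: 'a ell2). \<Sum>n. cinner (A (ell2_nth x n)) (ell2_nth y n)) euclidean"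

definition commutant :: "'a::complex_hilbert set \<Rightarrow> ('a \<Rightarrow>\<^sub>L 'a) set \<Rightarrow> ('a \<Rightarrow>\<^sub>L 'a) set" where
  "commutant K S = {A \<in> operators_on K. \<forall>B\<in>S. A o\<^sub>L B = B o\<^sub>L A}"

definition von_neumann_algebra :: "'a::complex_hilbert set \<Rightarrow> ('a \<Rightarrow>\<^sub>L 'a) set \<Rightarrow> bool" where
  "von_neumann_algebra K M \<longleftrightarrow> M \<subseteq> operators_on K \<and> csubspace M \<and>
     (\<forall>A\<in>M. \<forall>B\<in>M. A o\<^sub>L B \<in> M) \<and> (\<forall>A\<in>M. adj A \<in> M) \<and>
     commutant K (commutant K M) = M"

text \<open>\<open>amplify A\<close> is the tensor product of A with the identity of l2.\<close>

lift_definition ell2_map :: "('a::complex_hilbert \<Rightarrow>\<^sub>L 'a) \<Rightarrow> 'a ell2 \<Rightarrow> 'a ell2"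
  is "\<lambda>A x n. blinfun_apply A (x n)"
proof -
  fix A :: "'a \<Rightarrow>\<^sub>L 'a" and x :: "nat \<Rightarrow> 'a"
  assume "summable (\<lambda>n. (norm (x n))\<^sup>2)"
  then have "summable (\<lambda>n. (norm A)\<^sup>2 * (norm (x n))\<^sup>2)"
    by (rule summable_mult)
  then show "summable (\<lambda>n. (norm (A (x n)))\<^sup>2)"
    by (rule summable_comparison_test')
      (simp add: norm_blinfun power_mono flip: power_mult_distrib)
qed

lift_definition amplify :: "('a::complex_hilbert \<Rightarrow>\<^sub>L 'a) \<Rightarrow> 'a ell2 \<Rightarrow>\<^sub>L 'a ell2" is ell2_map
proof -
  fix A :: "'a \<Rightarrow>\<^sub>L 'a"
  show "bounded_linear (ell2_map A)"
  proof (rule bounded_linear_intro[where K = "norm A"])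
    fix x y :: "'a ell2" and r :: real
    show "ell2_map A (x + y) = ell2_map A x + ell2_map A y"
      by transfer (simp add: blinfun.add_right)
    show "ell2_map A (r *\<^sub>R x) = r *\<^sub>R ell2_map A x"
      by transfer (simp add: blinfun.scaleR_right)
    have "(norm (ell2_map A x))\<^sup>2 \<le> (\<Sum>n. (norm A)\<^sup>2 * (norm (ell2_nth x n))\<^sup>2)"
      unfolding norm_ell2_sq
    proof (rule suminf_le)
      show "(norm (ell2_nth (ell2_map A x) n))\<^sup>2 \<le> (norm A)\<^sup>2 * (norm (ell2_nth x n))\<^sup>2" for n
        by (simp add: ell2_map.rep_eq norm_blinfun power_mono flip: power_mult_distrib)
    qed (simp_all add: summable_ell2_norm summable_mult)
    also have "\<dots> = (norm x * norm A)\<^sup>2"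
      by (simp add: suminf_mult summable_ell2_norm norm_ell2_sq power_mult_distrib mult.commute)
    finally show "norm (ell2_map A x) \<le> norm x * norm A"
      by (simp add: power2_le_iff_abs_le)
  qed
qed

lemma amplify_tensor_vec: "amplify A (tensor_vec x s) = tensor_vec (A x) s"
  if "A \<in> operators_on UNIV"
  using that unfolding operators_on_def amplify.rep_eq
  by (simp add: ell2_map.rep_eq tensor_vec.rep_eq fun_eq_iff flip: ell2_nth_inject)

text \<open>The von Neumann algebra tensor product of M with B(l2). The operator T below
  is the tensor product of A and B, being determined by its values on the total set
  of elementary tensors.\<close>

definition tensor_B_ell2 ::
    "('a::complex_hilbert \<Rightarrow>\<^sub>L 'a) set \<Rightarrow> ('a ell2 \<Rightarrow>\<^sub>L 'a ell2) set" where
  "tensor_B_ell2 M = weakstar_topology closure_of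
     cspan {T :: 'a ell2 \<Rightarrow>\<^sub>L 'a ell2. T \<in> operators_on UNIV \<and>
       (\<exists>A\<in>M. \<exists>B\<in>operators_on UNIV. \<forall>x s. T (tensor_vec x s) = tensor_vec (A x) (B s))}"


section \<open>Quantum metrics\<close>

text \<open>A family indexed by the non-negative reals is a function on the reals whose
  values at negative arguments are never used.\<close>

definition quantum_metric ::
    "'a::complex_hilbert set \<Rightarrow> ('a \<Rightarrow>\<^sub>L 'a) set \<Rightarrow> (real \<Rightarrow> ('a \<Rightarrow>\<^sub>L 'a) set) \<Rightarrow> bool" where
  "quantum_metric K M V \<longleftrightarrow>
     (\<forall>t\<ge>0. V t \<subseteq> operators_on K \<and> csubspace (V t) \<and> closedin weakstar_topology (V t) \<and>
        (\<forall>A\<in>V t. adj A \<in> V t)) \<and>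
     V 0 = commutant K M \<and>
     (\<forall>s\<ge>0. \<forall>t\<ge>0. \<forall>A\<in>V s. \<forall>B\<in>V t. A o\<^sub>L B \<in> V (s + t)) \<and>
     (\<forall>t\<ge>0. V t = (\<Inter>s\<in>{t<..}. V s))"

definition reflexive :: "'a::complex_hilbert set \<Rightarrow> ('a \<Rightarrow>\<^sub>L 'a) set \<Rightarrow> bool" where
  "reflexive K S \<longleftrightarrow>
     S = {B \<in> operators_on K. \<forall>P\<in>projections (operators_on K). \<forall>Q\<in>projections (operators_on K).
            (\<forall>A\<in>S. P o\<^sub>L A o\<^sub>L Q = 0) \<longrightarrow> P o\<^sub>L B o\<^sub>L Q = 0}"

definition reflexive_metric ::
    "'a::complex_hilbert set \<Rightarrow> (real \<Rightarrow> ('a \<Rightarrow>\<^sub>L 'a) set) \<Rightarrow> bool" where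
  "reflexive_metric K V \<longleftrightarrow> (\<forall>t\<ge>0. reflexive K (V t))"

definition qdist :: "(real \<Rightarrow> ('a::complex_hilbert \<Rightarrow>\<^sub>L 'a) set) \<Rightarrow>
    ('a ell2 \<Rightarrow>\<^sub>L 'a ell2) \<Rightarrow> ('a ell2 \<Rightarrow>\<^sub>L 'a ell2) \<Rightarrow> ereal" where
  "qdist V P Q = Inf {ereal t | t. 0 \<le> t \<and> (\<exists>A\<in>V t. P o\<^sub>L amplify A o\<^sub>L Q \<noteq> 0)}"

definition qdiam :: "'a::complex_hilbert set \<Rightarrow> ('a \<Rightarrow>\<^sub>L 'a) set \<Rightarrow>
    (real \<Rightarrow> ('a \<Rightarrow>\<^sub>L 'a) set) \<Rightarrow> ('a \<Rightarrow>\<^sub>L 'a) \<Rightarrow> ereal" where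
  "qdiam K M V P =
     (if P = 0 then 0
      else Sup {qdist V Q R | Q R.
        Q \<in> projections (tensor_B_ell2 M) \<and> R \<in> projections (tensor_B_ell2 M) \<and>
        (\<exists>A\<in>operators_on K. Q o\<^sub>L amplify (P o\<^sub>L A o\<^sub>L P) o\<^sub>L R \<noteq> 0)})"

definition qnbhd :: "'a::complex_hilbert set \<Rightarrow> ('a \<Rightarrow>\<^sub>L 'a) set \<Rightarrow>
    (real \<Rightarrow> ('a \<Rightarrow>\<^sub>L 'a) set) \<Rightarrow> ('a \<Rightarrow>\<^sub>L 'a) \<Rightarrow> real \<Rightarrow> 'a \<Rightarrow>\<^sub>L 'a" where
  "qnbhd K M V P \<epsilon> =
     proj_onto K - proj_join {Q \<in> projections M. ereal \<epsilon> \<le> qdist V (amplify P) (amplify Q)}"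


section \<open>Asymptotic dimension\<close>

definition is_cover :: "'a::complex_hilbert set \<Rightarrow> ('a \<Rightarrow>\<^sub>L 'a) set \<Rightarrow> bool" where
  "is_cover K \<P> \<longleftrightarrow> proj_join \<P> = proj_onto K"

definition disjoint_family_at :: "'a::complex_hilbert set \<Rightarrow> ('a \<Rightarrow>\<^sub>L 'a) set \<Rightarrow>
    (real \<Rightarrow> ('a \<Rightarrow>\<^sub>L 'a) set) \<Rightarrow> real \<Rightarrow> ('a \<Rightarrow>\<^sub>L 'a) set \<Rightarrow> bool" where
  "disjoint_family_at K M V r \<P> \<longleftrightarrow>
     (\<forall>P\<in>\<P>. \<forall>Q\<in>\<P>. P \<noteq> Q \<longrightarrow> qnbhd K M V P r o\<^sub>L qnbhd K M V Q r = 0)"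

definition uniformly_bounded_family :: "'a::complex_hilbert set \<Rightarrow> ('a \<Rightarrow>\<^sub>L 'a) set \<Rightarrow>
    (real \<Rightarrow> ('a \<Rightarrow>\<^sub>L 'a) set) \<Rightarrow> ('a \<Rightarrow>\<^sub>L 'a) set \<Rightarrow> bool" where
  "uniformly_bounded_family K M V \<P> \<longleftrightarrow> (\<exists>R>0. (SUP P\<in>\<P>. qdiam K M V P) \<le> ereal R)"

definition asdim_le :: "'a::complex_hilbert set \<Rightarrow> ('a \<Rightarrow>\<^sub>L 'a) set \<Rightarrow>
    (real \<Rightarrow> ('a \<Rightarrow>\<^sub>L 'a) set) \<Rightarrow> nat \<Rightarrow> bool" where
  "asdim_le K M V n \<longleftrightarrow>
     (\<forall>r>0. \<exists>\<P> :: nat \<Rightarrow> ('a \<Rightarrow>\<^sub>L 'a) set.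
        (\<forall>i\<le>n. \<P> i \<subseteq> projections M \<and> uniformly_bounded_family K M V (\<P> i) \<and>
           disjoint_family_at K M V r (\<P> i)) \<and>
        is_cover K (\<Union>i\<le>n. \<P> i))"

definition asdim :: "'a::complex_hilbert set \<Rightarrow> ('a \<Rightarrow>\<^sub>L 'a) set \<Rightarrow>
    (real \<Rightarrow> ('a \<Rightarrow>\<^sub>L 'a) set) \<Rightarrow> enat" where
  "asdim K M V = Inf {enat n | n. asdim_le K M V n}"


section \<open>Metric quotients\<close>

definition central_projection :: "('a::complex_hilbert \<Rightarrow>\<^sub>L 'a) set \<Rightarrow> ('a \<Rightarrow>\<^sub>L 'a) \<Rightarrow> bool" where
  "central_projection M R \<longleftrightarrow> R \<in> projections M \<and> (\<forall>A\<in>M. R o\<^sub>L A = A o\<^sub>L R)"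

text \<open>The metric quotient given by R lives on the Hilbert space \<open>range R\<close>.\<close>

definition quotient_algebra ::
    "('a::complex_hilbert \<Rightarrow>\<^sub>L 'a) \<Rightarrow> ('a \<Rightarrow>\<^sub>L 'a) set \<Rightarrow> ('a \<Rightarrow>\<^sub>L 'a) set" where
  "quotient_algebra R M = (\<lambda>A. R o\<^sub>L A) ` M"

definition quotient_metric :: "('a::complex_hilbert \<Rightarrow>\<^sub>L 'a) \<Rightarrow>
    (real \<Rightarrow> ('a \<Rightarrow>\<^sub>L 'a) set) \<Rightarrow> real \<Rightarrow> ('a \<Rightarrow>\<^sub>L 'a) set" where
  "quotient_metric R V t = (\<lambda>A. R o\<^sub>L A o\<^sub>L R) ` V t"

end

(* Call P and Q e-separated if P A Q = 0 for all A in V_t with t < e, and t-controlled if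
   P B(H) Q is contained in V_t. Reflexivity allows membership in V_t to be tested on pairs of
   projections of M. Hence a bound on diam(P) makes the pair P, P controlled, control passes to
   joins, and if P, Q are a-controlled, Q', S are b-controlled and Q V_s Q' is nonzero, then P, S
   are (a+s+b)-controlled.
   The range of the r-neighbourhood of P is the closed span of the ranges of A P with A in V_t,
   t < r. So 2r-separated projections have orthogonal r-neighbourhoods, and conversely orthogonal
   e-neighbourhoods imply e-separation; the converse survives passing to the metric quotient of R
   because R lies in V_0.
   Given pairwise e-separated, d1-controlled families U covering R1 and pairwise
   (2e+d1)-separated, d2-controlled families W covering R2, the covers are merged as in the
   classical union theorem: each member of W absorbs the members of U that are not e-separated
   from it, and the other members of U are kept. *)
theory Submission
  imports Defs
begin

section \<open>Projections and adjoints\<close>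

lemma exists_orthogonal_projection:
  fixes x :: "'a::{real_inner,complete_space}"
  assumes K: "subspace K" "closed K"
  shows "\<exists>p\<in>K. \<forall>k\<in>K. inner (x - p) k = 0"
proof -
  define D where "D = Inf ((\<lambda>k. (norm (x - k))\<^sup>2) ` K)"
  have bdd: "bdd_below ((\<lambda>k. (norm (x - k))\<^sup>2) ` K)"
    by (rule bdd_belowI[of _ 0]) auto
  have ne: "K \<noteq> {}"
    using subspace_0[OF K(1)] by auto
  have D_le: "D \<le> (norm (x - k))\<^sup>2" if "k \<in> K" for k
    unfolding D_def by (rule cInf_lower[OF _ bdd]) (use that in auto)
  have "\<exists>k\<in>K. (norm (x - k))\<^sup>2 < D + inverse (real (Suc n))" for n
    using cInf_lessD[of "(\<lambda>k. (norm (x - k))\<^sup>2) ` K" "D + inverse (real (Suc n))"] ne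
    unfolding D_def by auto
  then obtain k where k: "\<And>n. k n \<in> K"
    and kD: "\<And>n. (norm (x - k n))\<^sup>2 < D + inverse (real (Suc n))"
    by metis
  \<comment> \<open>The midpoint of \<open>k m\<close> and \<open>k n\<close> lies in
    \<open>K\<close>, so the parallelogram law turns near-minimality of both into closeness: the
    minimising sequence is Cauchy.\<close>
  have par: "(norm (k m - k n))\<^sup>2 \<le> 2 * inverse (real (Suc m)) + 2 * inverse (real (Suc n))" for m n
  proof -
    have "(1/2) *\<^sub>R (k m + k n) \<in> K"
      using K(1) k by (intro subspace_scale subspace_add)
    then have "D \<le> (norm (x - (1/2) *\<^sub>R (k m + k n)))\<^sup>2"
      by (rule D_le)
    moreover have "(norm (k m - k n))\<^sup>2 = 2 * (norm (x - k m))\<^sup>2 + 2 * (norm (x - k n))\<^sup>2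
        - 4 * (norm (x - (1/2) *\<^sub>R (k m + k n)))\<^sup>2"
      unfolding power2_norm_eq_inner
      by (simp add: algebra_simps inner_commute)
    ultimately show ?thesis
      using kD[of m] kD[of n] by linarith
  qed
  have "Cauchy k"
  proof (rule metric_CauchyI)
    fix e :: real assume "0 < e"
    then obtain N where N: "inverse (real (Suc N)) < e\<^sup>2 / 4"
      using reals_Archimedean[of "e\<^sup>2 / 4"] by auto
    have "dist (k m) (k n) < e" if "m \<ge> N" "n \<ge> N" for m n
    proof -
      have "inverse (real (Suc m)) \<le> inverse (real (Suc N))"
        "inverse (real (Suc n)) \<le> inverse (real (Suc N))"
        using that by (auto intro!: le_imp_inverse_le)
      then have "(norm (k m - k n))\<^sup>2 < e\<^sup>2"
        using par[of m n] N by linarith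
      then show ?thesis
        using \<open>0 < e\<close> by (simp add: dist_norm power2_less_imp_less)
    qed
    then show "\<exists>N. \<forall>m\<ge>N. \<forall>n\<ge>N. dist (k m) (k n) < e"
      by blast
  qed
  then obtain p where p: "k \<longlonglongrightarrow> p"
    by (auto simp: Cauchy_convergent_iff convergent_def)
  have pK: "p \<in> K"
    using closed_sequentially[OF K(2)] k p by blast
  have "(norm (x - p))\<^sup>2 \<le> D"
  proof (rule LIMSEQ_le)
    show "(\<lambda>n. (norm (x - k n))\<^sup>2) \<longlonglongrightarrow> (norm (x - p))\<^sup>2"
      by (intro tendsto_intros p)
    show "(\<lambda>n. D + inverse (real (Suc n))) \<longlonglongrightarrow> D"
      using tendsto_add[OF tendsto_const LIMSEQ_inverse_real_of_nat, of D] by simp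
    show "\<exists>N. \<forall>n\<ge>N. (norm (x - k n))\<^sup>2 \<le> D + inverse (real (Suc n))"
      using kD less_imp_le by blast
  qed
  then have min: "(norm (x - p))\<^sup>2 \<le> (norm (x - q))\<^sup>2" if "q \<in> K" for q
    using D_le[OF that] by linarith
  have "inner (x - p) q = 0" if q: "q \<in> K" for q
  proof (cases "q = 0")
    case False
    \<comment> \<open>This \<open>t\<close> minimises the squared distance from \<open>x\<close> to
      \<open>p + t *\<^sub>R q\<close>, a quadratic polynomial in \<open>t\<close>.\<close>
    define t where "t = inner (x - p) q / inner q q"
    have "p + t *\<^sub>R q \<in> K"
      using K(1) q pK by (intro subspace_scale subspace_add)
    from min[OF this] have "2 * t * inner (x - p) q \<le> t\<^sup>2 * inner q q"
      unfolding power2_norm_eq_inner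
      by (simp add: algebra_simps inner_commute power2_eq_square)
    then have "(inner (x - p) q)\<^sup>2 \<le> 0"
      using False by (simp add: t_def power2_eq_square field_simps)
    then show ?thesis
      by simp
  qed simp
  with pK show ?thesis
    by blast
qed

text \<open>A vector \<open>u\<close> orthogonal to the kernel of \<open>f\<close> spans a
  complement of it: \<open>z - (f z / f u) *\<^sub>R u\<close> always lies in the kernel, and
  pairing it with \<open>u\<close> recovers \<open>f z\<close>.\<close>

lemma riesz_representation:
  fixes f :: "'a::{real_inner,complete_space} \<Rightarrow> real"
  assumes "bounded_linear f"
  shows "\<exists>y. \<forall>x. f x = inner x y"
proof (cases "\<forall>x. f x = 0")
  case True
  then show ?thesis
    by (intro exI[of _ 0]) simp
next
  case False
  interpret f: bounded_linear f
    by fact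
  obtain x where x: "f x \<noteq> 0"
    using False by blast
  have "subspace {x. f x = 0}"
    by (rule subspaceI) (simp_all add: f.add f.scaleR f.zero)
  moreover have "closed {x. f x = 0}"
    by (intro closed_Collect_eq f.continuous_on continuous_intros)
  ultimately obtain p where p: "f p = 0" and orth: "\<And>k. f k = 0 \<Longrightarrow> inner (x - p) k = 0"
    using exists_orthogonal_projection[of "{x. f x = 0}" x] by auto
  define u where "u = x - p"
  have fu: "f u \<noteq> 0"
    using x p by (simp add: u_def f.diff)
  then have uu: "inner u u \<noteq> 0"
    by (auto simp: f.zero)
  have "f z = inner z ((f u / inner u u) *\<^sub>R u)" for z
  proof -
    have "f (z - (f z / f u) *\<^sub>R u) = 0"
      using fu by (simp add: f.diff f.scaleR)
    from orth[OF this] have "inner u z = (f z / f u) * inner u u"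
      by (simp add: u_def[symmetric] inner_diff_right)
    then show ?thesis
      using fu uu by (simp add: field_simps inner_commute)
  qed
  then show ?thesis
    by blast
qed

lemma exists_real_adjoint:
  fixes A :: "'a::{real_inner,complete_space} \<Rightarrow>\<^sub>L 'a"
  shows "\<exists>B :: 'a \<Rightarrow>\<^sub>L 'a. \<forall>x y. inner (A x) y = inner x (B y)"
proof -
  have "\<exists>z. \<forall>x. inner (A x) y = inner x z" for y
    by (intro riesz_representation bounded_linear_intros)
  then obtain g where g: "\<And>x y. inner (A x) y = inner x (g y)"
    by metis
  have "bounded_linear g"
  proof (rule bounded_linear_intro[where K = "norm A"])
    fix x y :: 'a and r :: real
    show "g (x + y) = g x + g y"
      by (subst vector_eq_ldot[symmetric]) (simp add: inner_add_right flip: g)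
    show "g (r *\<^sub>R x) = r *\<^sub>R g x"
      by (subst vector_eq_ldot[symmetric]) (simp flip: g)
    have "(norm (g x))\<^sup>2 = inner (A (g x)) x"
      by (simp add: g power2_norm_eq_inner)
    also have "\<dots> \<le> norm (A (g x)) * norm x"
      by (rule norm_cauchy_schwarz)
    also have "\<dots> \<le> norm A * norm (g x) * norm x"
      by (intro mult_right_mono norm_blinfun) simp
    finally have "norm (g x) * norm (g x) \<le> norm (g x) * (norm x * norm A)"
      by (simp add: power2_eq_square mult_ac)
    then show "norm (g x) \<le> norm x * norm A"
      by (cases "norm (g x) = 0") (simp_all add: mult_le_cancel_left)
  qed
  then show ?thesis
    using g by (intro exI[of _ "Blinfun g"]) (simp add: bounded_linear_Blinfun_apply)
qed

section \<open>Complex inner products, complex-linear operators and adjoints\<close>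

lemma cinner_scaleC_right: "cinner x (c *\<^sub>C y) = cnj c * cinner x y"
  by (metis cinner_commute cinner_scaleC_left complex_cnj_mult)

lemma cinner_add_right: "cinner x (y + z) = cinner x y + cinner x z"
  by (metis cinner_add_left cinner_commute complex_cnj_add)

lemma cinner_eq_inner: "cinner x y = Complex (inner x y) (inner x (\<i> *\<^sub>C y))"
  by (simp add: complex_eq_iff cinner_scaleC_right flip: Re_cinner)

lemma cinner_diff_left: "cinner (x - y) z = cinner x z - cinner y z"
  using cinner_add_left[of "x - y" y z] by simp

lemma cinner_diff_right: "cinner x (y - z) = cinner x y - cinner x z"
  using cinner_add_right[of x "y - z" z] by simp

lemma cinner_zero_right [simp]: "cinner x 0 = 0"
  using cinner_add_right[of x 0 0] by simp

lemma cinner_zero_left [simp]: "cinner 0 x = 0"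
  using cinner_add_left[of 0 0 x] by simp

lemma cinner_self_eq_0: "cinner x x = 0 \<Longrightarrow> x = 0"
  by (metis Re_cinner inner_eq_zero_iff zero_complex.simps(1))

lemma cinner_extensionality: "(\<And>z. cinner z x = cinner z y) \<Longrightarrow> x = y"
  by (metis Re_cinner vector_eq_ldot)

lemma operators_on_UNIV_iff:
  "A \<in> operators_on UNIV \<longleftrightarrow> (\<forall>c x. blinfun_apply A (c *\<^sub>C x) = c *\<^sub>C blinfun_apply A x)"
proof -
  have "A x = 0" if "\<And>y. cinner x y = 0" for x
    using cinner_self_eq_0[OF that] by (simp add: blinfun.zero_right)
  then show ?thesis
    unfolding operators_on_def by auto
qed

lemma blinfun_apply_scaleC:
  "A \<in> operators_on UNIV \<Longrightarrow> blinfun_apply A (c *\<^sub>C x) = c *\<^sub>C blinfun_apply A x"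
  by (simp add: operators_on_UNIV_iff)

lemma operators_on_UNIV_compose:
  "A \<in> operators_on UNIV \<Longrightarrow> B \<in> operators_on UNIV \<Longrightarrow> A o\<^sub>L B \<in> operators_on UNIV"
  by (simp add: operators_on_UNIV_iff)

lemma id_in_operators_on_UNIV: "id_blinfun \<in> operators_on UNIV"
  by (simp add: operators_on_UNIV_iff)

lemma scaleC_diff_right: "c *\<^sub>C (x - y) = c *\<^sub>C x - c *\<^sub>C (y::'a::complex_vector)"
  by (rule complex_vector.scale_right_diff_distrib)

lemma operators_on_UNIV_diff:
  "A \<in> operators_on UNIV \<Longrightarrow> B \<in> operators_on UNIV \<Longrightarrow> A - B \<in> operators_on UNIV"
  by (simp add: operators_on_UNIV_iff blinfun.diff_left scaleC_diff_right)

lemma adjoint_unique: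
  fixes A B C :: "'a::complex_hilbert \<Rightarrow>\<^sub>L 'a"
  assumes "\<And>x y. cinner (A x) y = cinner x (B y)" "\<And>x y. cinner (A x) y = cinner x (C y)"
  shows "B = C"
  by (rule blinfun_eqI, rule cinner_extensionality) (metis assms)

text \<open>The real adjoint is also the complex one, because \<open>A\<close> commutes with
  multiplication by \<i>, which is skew for the real inner product. Uniqueness then identifies it
  with the definite description in \<open>adj\<close>.\<close>

lemma cinner_adj:
  fixes A :: "'a::complex_hilbert \<Rightarrow>\<^sub>L 'a"
  assumes A: "A \<in> operators_on UNIV"
  shows "cinner (A x) y = cinner x (adj A y)"
proof -
  obtain B :: "'a \<Rightarrow>\<^sub>L 'a" where B: "\<And>x y. inner (A x) y = inner x (B y)"
    using exists_real_adjoint[of A] by blast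
  have i: "inner u (\<i> *\<^sub>C v) = - inner (\<i> *\<^sub>C u) v" for u v :: 'a
    by (simp add: cinner_scaleC_right cinner_scaleC_left flip: Re_cinner)
  have *: "cinner (A x) y = cinner x (B y)" for x y
    using A by (simp add: cinner_eq_inner B i flip: blinfun_apply_scaleC)
  have "adj A = B"
    unfolding adj_def by (rule the_equality) (auto simp: * intro: adjoint_unique[of A])
  then show ?thesis
    by (simp add: *)
qed

lemma cinner_adj_right:
  "A \<in> operators_on UNIV \<Longrightarrow> cinner (blinfun_apply (adj A) x) y = cinner x (blinfun_apply A y)"
  by (metis cinner_adj cinner_commute)

lemma adj_in_operators_on_UNIV: "A \<in> operators_on UNIV \<Longrightarrow> adj A \<in> operators_on UNIV"
  unfolding operators_on_UNIV_iff[of "adj A"]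
  by (rule allI, rule allI, rule cinner_extensionality) (simp add: cinner_scaleC_right flip: cinner_adj)

lemma adj_adj: "A \<in> operators_on UNIV \<Longrightarrow> adj (adj A) = A"
  by (rule blinfun_eqI, rule cinner_extensionality)
    (simp add: cinner_adj_right flip: cinner_adj[OF adj_in_operators_on_UNIV])

lemma adj_compose:
  "A \<in> operators_on UNIV \<Longrightarrow> B \<in> operators_on UNIV \<Longrightarrow> adj (A o\<^sub>L B) = adj B o\<^sub>L adj A"
  by (rule blinfun_eqI, rule cinner_extensionality)
    (simp add: operators_on_UNIV_compose flip: cinner_adj)

section \<open>Orthogonal projections and their ranges\<close>

abbreviation is_projection :: "('a::complex_hilbert \<Rightarrow>\<^sub>L 'a) \<Rightarrow> bool" where
  "is_projection P \<equiv> P \<in> projections UNIV"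

lemma projections_iff: "P \<in> projections S \<longleftrightarrow> P \<in> S \<and> is_projection P"
  by (auto simp: projections_def)

lemma is_projectionD:
  assumes "is_projection P"
  shows "P \<in> operators_on UNIV" "P o\<^sub>L P = P" "blinfun_apply P (blinfun_apply P x) = blinfun_apply P x"
    "cinner (blinfun_apply P x) y = cinner x (blinfun_apply P y)"
  using assms by (auto simp: projections_def) (metis blinfun_apply_blinfun_compose)

lemma is_projection_adj: "is_projection P \<Longrightarrow> adj P = P"
  by (metis adjoint_unique cinner_adj is_projectionD(1,4))

lemma is_projection_id: "is_projection id_blinfun"
  by (auto simp: projections_def id_in_operators_on_UNIV intro!: blinfun_eqI)

lemma is_projection_zero: "is_projection 0"
  by (auto simp: projections_def operators_on_UNIV_iff)

lemma in_range_projection_iff: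
  "is_projection P \<Longrightarrow> x \<in> range (blinfun_apply P) \<longleftrightarrow> blinfun_apply P x = x"
  by (metis is_projectionD(3) rangeE rangeI)

lemma is_projection_complement:
  assumes P: "is_projection P"
  shows "is_projection (id_blinfun - P)"
proof -
  have "id_blinfun - P \<in> operators_on UNIV"
    by (intro operators_on_UNIV_diff id_in_operators_on_UNIV is_projectionD(1) P)
  moreover have "(id_blinfun - P) o\<^sub>L (id_blinfun - P) = id_blinfun - P"
    by (rule blinfun_eqI)
      (simp add: blinfun.diff_left blinfun.diff_right is_projectionD(3)[OF P])
  moreover have "cinner ((id_blinfun - P) x) y = cinner x ((id_blinfun - P) y)" for x y
    by (simp add: blinfun.diff_left cinner_diff_left cinner_diff_right is_projectionD(4)[OF P])
  ultimately show ?thesis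
    by (simp add: projections_def)
qed

lemma projection_product_zero_commute:
  assumes "is_projection P" "is_projection Q" "P o\<^sub>L Q = 0"
  shows "Q o\<^sub>L P = 0"
  by (metis assms adj_compose is_projection_adj is_projectionD(1) is_projection_zero)

text \<open>Each projection fixes the range of the other, so \<open>P o\<^sub>L Q = Q\<close> and
  \<open>Q o\<^sub>L P = P\<close>; taking adjoints in the first identity and comparing with the
  second gives equality.\<close>

lemma projection_eq_of_range_eq:
  assumes P: "is_projection P" and Q: "is_projection Q"
    and r: "range (blinfun_apply P) = range (blinfun_apply Q)"
  shows "P = Q"
proof -
  have "P (Q x) = Q x" "Q (P x) = P x" for x
    using in_range_projection_iff[OF P, of "Q x"] in_range_projection_iff[OF Q, of "P x"]
    by (simp_all add: r) (simp flip: r)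
  then have "P o\<^sub>L Q = Q" "Q o\<^sub>L P = P"
    by (auto intro!: blinfun_eqI)
  then show ?thesis
    by (metis adj_compose P Q is_projection_adj is_projectionD(1))
qed

lemma csubspace_imp_subspace: "csubspace K \<Longrightarrow> subspace K"
  by (rule subspaceI) (simp_all add: scaleR_eq_scaleC complex_vector.subspace_0
      complex_vector.subspace_add complex_vector.subspace_scale)

text \<open>The real nearest-point map works. Since \<open>K\<close> is closed under multiplication
  by \<i>, real orthogonality to \<open>K\<close> is complex orthogonality, and uniqueness of the
  orthogonal decomposition yields complex linearity.\<close>

lemma exists_projection_onto:
  fixes K :: "'a::complex_hilbert set"
  assumes K: "csubspace K" "closed K"
  shows "\<exists>P. is_projection P \<and> range (blinfun_apply P) = K"
proof -
  note sub = csubspace_imp_subspace[OF K(1)]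
  have iK: "\<i> *\<^sub>C k \<in> K" if "k \<in> K" for k
    using that K(1) by (simp add: complex_vector.subspace_scale)
  obtain g where g: "\<And>x. g x \<in> K" and "\<And>x k. k \<in> K \<Longrightarrow> inner (x - g x) k = 0"
    using exists_orthogonal_projection[OF sub K(2)] by metis
  then have orth: "k \<in> K \<Longrightarrow> cinner (x - g x) k = 0" for x k
    using iK by (simp add: cinner_eq_inner complex_eq_iff)
  have uniq: "g x = p" if "p \<in> K" and p: "\<And>k. k \<in> K \<Longrightarrow> cinner (x - p) k = 0" for x p
  proof -
    have d: "g x - p \<in> K"
      using g that(1) K(1) by (simp add: complex_vector.subspace_diff)
    have "cinner (g x - p) (g x - p) = cinner (x - p) (g x - p) - cinner (x - g x) (g x - p)"
      by (simp add: cinner_diff_left)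
    also have "\<dots> = 0"
      using p[OF d] orth[OF d] by simp
    finally show ?thesis
      using cinner_self_eq_0 by fastforce
  qed
  have add: "g (x + y) = g x + g y" for x y
  proof (rule uniq)
    show "g x + g y \<in> K"
      using g K(1) by (simp add: complex_vector.subspace_add)
    fix k assume k: "k \<in> K"
    have "x + y - (g x + g y) = (x - g x) + (y - g y)"
      by simp
    then show "cinner (x + y - (g x + g y)) k = 0"
      using orth[OF k] by (simp only: cinner_add_left) simp
  qed
  have scaleC: "g (c *\<^sub>C x) = c *\<^sub>C g x" for c x
    using g K(1) orth
    by (intro uniq) (simp_all add: complex_vector.subspace_scale cinner_scaleC_left
        flip: scaleC_diff_right)
  have sym: "cinner (g x) y = cinner x (g y)" for x y
  proof -
    have "cinner (x - g x) (g y) = 0" "cinner (y - g y) (g x) = 0"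
      using orth g by auto
    then show ?thesis
      by (metis cinner_diff_left cinner_commute eq_iff_diff_eq_0)
  qed
  have gg: "g k = k" if "k \<in> K" for k
    using that by (intro uniq) auto
  have "bounded_linear g"
  proof (rule bounded_linear_intro[where K = 1])
    show "g (r *\<^sub>R x) = r *\<^sub>R g x" for r x
      by (simp add: scaleR_eq_scaleC scaleC)
    fix x
    have "inner (g x) (g x) = inner x (g x)"
      by (metis Re_cinner sym gg[OF g])
    then have "norm (g x) * norm (g x) \<le> norm (g x) * norm x"
      by (metis norm_cauchy_schwarz power2_norm_eq_inner power2_eq_square mult.commute)
    then show "norm (g x) \<le> norm x * 1"
      by (cases "norm (g x) = 0") (simp_all add: mult_le_cancel_left)
  qed (rule add)
  then have app: "blinfun_apply (Blinfun g) = g"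
    by (rule bounded_linear_Blinfun_apply)
  have "is_projection (Blinfun g)"
    by (auto simp: projections_def operators_on_UNIV_iff app scaleC sym gg g intro!: blinfun_eqI)
  moreover have "range g = K"
    using g gg by (metis image_subsetI rangeI subsetI subset_antisym)
  ultimately show ?thesis
    using app by metis
qed

lemma proj_onto:
  assumes "csubspace K" "closed K"
  shows "is_projection (proj_onto K)" "range (blinfun_apply (proj_onto K)) = K"
proof -
  have "is_projection (proj_onto K) \<and> range (blinfun_apply (proj_onto K)) = K"
    unfolding proj_onto_def
  proof (rule theI', rule ex_ex1I)
    show "\<exists>P. is_projection P \<and> range (blinfun_apply P) = K"
      by (rule exists_projection_onto[OF assms])
  qed (auto dest: projection_eq_of_range_eq)
  then show "is_projection (proj_onto K)" "range (blinfun_apply (proj_onto K)) = K"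
    by auto
qed

lemma proj_onto_range: "is_projection P \<Longrightarrow> proj_onto (range (blinfun_apply P)) = P"
  unfolding proj_onto_def by (rule the_equality) (auto dest: projection_eq_of_range_eq)

lemma proj_onto_UNIV: "proj_onto UNIV = id_blinfun"
  using proj_onto_range[OF is_projection_id] by simp

section \<open>Closed complex spans, joins and rank-one operators\<close>

lemma csubspace_closure:
  fixes K :: "'a::complex_hilbert set"
  assumes K: "csubspace K"
  shows "csubspace (closure K)"
  unfolding complex_vector.subspace_def
proof (intro conjI ballI allI)
  show "0 \<in> closure K"
    using K closure_subset complex_vector.subspace_0 by blast
  fix x assume x: "x \<in> closure K"
  then obtain f where f: "\<And>n. f n \<in> K" "f \<longlonglongrightarrow> x"
    by (auto simp: closure_sequential)
  {
    fix y assume "y \<in> closure K"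
    then obtain h where h: "\<And>n. h n \<in> K" "h \<longlonglongrightarrow> y"
      by (auto simp: closure_sequential)
    show "x + y \<in> closure K"
      unfolding closure_sequential
      by (rule exI[of _ "\<lambda>n. f n + h n"])
        (use f h K in \<open>auto intro!: tendsto_add simp: complex_vector.subspace_add\<close>)
  }
  fix c :: complex
  have "(\<lambda>n. c *\<^sub>C f n) \<longlonglongrightarrow> c *\<^sub>C x"
  proof -
    have "(\<lambda>n. blinfun_apply (c *\<^sub>C id_blinfun) (f n)) \<longlonglongrightarrow> blinfun_apply (c *\<^sub>C id_blinfun) x"
      by (intro tendsto_intros f)
    then show ?thesis
      by (simp add: scaleC_blinfun.rep_eq)
  qed
  then show "c *\<^sub>C x \<in> closure K"
    unfolding closure_sequential
    by (intro exI[of _ "\<lambda>n. c *\<^sub>C f n"]) (use f K in \<open>auto simp: complex_vector.subspace_scale\<close>)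
qed

text \<open>One construction serves both for joins of projections and for projections onto closed
  spans of vectors \<open>A (P x)\<close> with \<open>A\<close> taken from the quantum
  metric.\<close>

definition span_proj :: "'a::complex_hilbert set \<Rightarrow> 'a \<Rightarrow>\<^sub>L 'a" where
  "span_proj X = proj_onto (closure (cspan X))"

lemma closed_csubspace_closure_cspan:
  "csubspace (closure (cspan X))" "closed (closure (cspan (X :: 'a::complex_hilbert set)))"
  by (simp_all add: csubspace_closure)

lemma is_projection_span_proj: "is_projection (span_proj X)"
  and range_span_proj: "range (blinfun_apply (span_proj X)) = closure (cspan X)"
  unfolding span_proj_def by (rule proj_onto[OF closed_csubspace_closure_cspan])+

lemma span_proj_fixes: "x \<in> X \<Longrightarrow> blinfun_apply (span_proj X) x = x"
  unfolding in_range_projection_iff[OF is_projection_span_proj, symmetric] range_span_proj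
  by (rule subsetD[OF closure_subset complex_vector.span_base])

text \<open>The kernel of a bounded complex-linear operator is a closed complex subspace, so it
  contains the closed span of \<open>X\<close> once it contains \<open>X\<close>.\<close>

lemma compose_span_proj_eq_0:
  fixes B :: "'a::complex_hilbert \<Rightarrow>\<^sub>L 'a"
  assumes B: "B \<in> operators_on UNIV" and X: "\<And>x. x \<in> X \<Longrightarrow> B x = 0"
  shows "B o\<^sub>L span_proj X = 0"
proof -
  have "cspan X \<subseteq> {x. B x = 0}"
  proof (rule complex_vector.span_minimal)
    show "csubspace {x. B x = 0}"
      unfolding complex_vector.subspace_def
      by (simp add: blinfun_apply_scaleC[OF B] blinfun.add_right)
  qed (use X in auto)
  moreover have "closed {x. B x = 0}"
    by (intro closed_Collect_eq continuous_intros)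
  ultimately have "closure (cspan X) \<subseteq> {x. B x = 0}"
    by (rule closure_minimal)
  moreover have "span_proj X x \<in> closure (cspan X)" for x
    unfolding range_span_proj[symmetric] by (rule rangeI)
  ultimately show ?thesis
    by (intro blinfun_eqI) (auto simp del: closure_subset_eq)
qed

lemma proj_join_eq_span_proj: "proj_join S = span_proj (\<Union>P\<in>S. range (blinfun_apply P))"
  by (simp add: proj_join_def span_proj_def)

lemma is_projection_proj_join: "is_projection (proj_join S)"
  by (simp add: proj_join_eq_span_proj is_projection_span_proj)

lemma proj_join_absorbs: "P \<in> S \<Longrightarrow> proj_join S o\<^sub>L P = P"
  unfolding proj_join_eq_span_proj
  by (rule blinfun_eqI) (simp, rule span_proj_fixes, blast)

lemma compose_proj_join_eq_0:
  assumes "B \<in> operators_on UNIV" "\<And>P. P \<in> S \<Longrightarrow> B o\<^sub>L P = 0"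
  shows "B o\<^sub>L proj_join S = 0"
proof -
  have "B (P x) = 0" if "P \<in> S" for P x
    using assms(2)[OF that] by (metis blinfun_apply_blinfun_compose blinfun.zero_left)
  then show ?thesis
    unfolding proj_join_eq_span_proj by (intro compose_span_proj_eq_0 assms) auto
qed

text \<open>Primeness of B(H). If \<open>P y\<close> and \<open>Q x\<close> are nonzero, the
  rank-one operator sending \<open>z\<close> to \<open>cinner z (Q x) *\<^sub>C y\<close> serves:
  the triple product maps \<open>x\<close> to a nonzero multiple of \<open>P y\<close>.\<close>

lemma exists_rank_one_nonzero:
  assumes P: "P \<in> operators_on UNIV" "P \<noteq> 0" and Q: "Q \<noteq> (0 :: 'a::complex_hilbert \<Rightarrow>\<^sub>L 'a)"
  shows "\<exists>A\<in>operators_on UNIV. P o\<^sub>L A o\<^sub>L Q \<noteq> 0"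
proof -
  obtain y where y: "P y \<noteq> 0"
    using P(2) by (metis blinfun_eqI blinfun.zero_left)
  obtain x where x: "Q x \<noteq> 0"
    using Q by (metis blinfun_eqI blinfun.zero_left)
  define f where "f = (\<lambda>z. cinner z (Q x) *\<^sub>C y)"
  have "bounded_linear f"
  proof (rule bounded_linear_intro[where K = "norm (Q x) * norm y"])
    show "f (a + b) = f a + f b" for a b
      by (simp add: f_def cinner_add_left scaleC_add_left)
    show "f (r *\<^sub>R a) = r *\<^sub>R f a" for r a
      by (simp add: f_def cinner_scaleC_left scaleR_eq_scaleC scaleC_scaleC)
    show "norm (f a) \<le> norm a * (norm (Q x) * norm y)" for a
      using mult_right_mono[OF norm_cinner_le[of a "Q x"] norm_ge_zero[of y]]
      by (simp add: f_def norm_scaleC mult.assoc)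
  qed
  then have app: "blinfun_apply (Blinfun f) = f"
    by (rule bounded_linear_Blinfun_apply)
  have "Blinfun f \<in> operators_on UNIV"
    by (simp add: operators_on_UNIV_iff app) (simp add: f_def cinner_scaleC_left scaleC_scaleC)
  moreover have "(P o\<^sub>L Blinfun f o\<^sub>L Q) x = cinner (Q x) (Q x) *\<^sub>C P y"
    by (simp add: app) (simp add: f_def blinfun_apply_scaleC[OF P(1)])
  then have "(P o\<^sub>L Blinfun f o\<^sub>L Q) x \<noteq> 0"
    using x y cinner_self_eq_0 complex_vector.scale_eq_0_iff by metis
  ultimately show ?thesis
    by (metis blinfun.zero_left)
qed

lemma blinfun_compose_assoc: "(A o\<^sub>L B) o\<^sub>L C = A o\<^sub>L (B o\<^sub>L C)"
  by (rule blinfun_eqI) simp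

lemma blinfun_compose_id [simp]: "A o\<^sub>L id_blinfun = A" "id_blinfun o\<^sub>L A = A"
  by (rule blinfun_eqI, simp)+

lemma blinfun_compose_diff_left: "(A - B) o\<^sub>L C = (A o\<^sub>L C) - (B o\<^sub>L C)"
  by (rule blinfun_eqI) (simp add: blinfun.diff_left)

lemma blinfun_compose_diff_right: "A o\<^sub>L (B - C) = (A o\<^sub>L B) - (A o\<^sub>L C)"
  by (rule blinfun_eqI) (simp add: blinfun.diff_left blinfun.diff_right)

lemma blinfun_eq_0D: "A = 0 \<Longrightarrow> blinfun_apply A x = 0"
  by simp

lemma adj_zero: "adj (0 :: 'a::complex_hilbert \<Rightarrow>\<^sub>L 'a) = 0"
  by (rule is_projection_adj[OF is_projection_zero])

section \<open>Distances between projections\<close>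

lemma amplify_compose: "amplify A o\<^sub>L amplify B = amplify (A o\<^sub>L B)"
  by (rule blinfun_eqI)
    (simp add: amplify.rep_eq ell2_map.rep_eq fun_eq_iff flip: ell2_nth_inject)

lemma amplify_eq_0_iff:
  fixes A :: "'a::complex_hilbert \<Rightarrow>\<^sub>L 'a"
  shows "amplify A = 0 \<longleftrightarrow> A = 0"
proof
  assume A: "amplify A = 0"
  show "A = 0"
  proof (rule blinfun_eqI)
    fix x :: 'a
    \<comment> \<open>Sequences supported at index 0 form a copy of \<open>H\<close> on which the
      amplification acts as \<open>A\<close>.\<close>
    define e where "e = Abs_ell2 (\<lambda>n. if n = (0::nat) then x else 0)"
    have "summable (\<lambda>n. (norm (if n = (0::nat) then x else 0))\<^sup>2)"
      by (rule summable_finite[of "{0}"]) auto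
    then have "ell2_nth e 0 = x"
      by (simp add: e_def Abs_ell2_inverse)
    moreover have "ell2_nth (amplify A e) 0 = A (ell2_nth e 0)"
      by (simp add: amplify.rep_eq ell2_map.rep_eq)
    ultimately show "A x = blinfun_apply 0 x"
      using A by simp
  qed
next
  assume "A = 0"
  then show "amplify A = 0"
    by (intro blinfun_eqI)
      (simp add: amplify.rep_eq ell2_map.rep_eq fun_eq_iff flip: ell2_nth_inject)
qed

lemma is_projection_amplify:
  assumes P: "is_projection P"
  shows "is_projection (amplify P)"
proof -
  have "amplify P \<in> operators_on UNIV"
    using is_projectionD(1)[OF P]
    by (simp add: operators_on_UNIV_iff amplify.rep_eq ell2_map.rep_eq fun_eq_iff
        flip: ell2_nth_inject)
  moreover have "amplify P o\<^sub>L amplify P = amplify P"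
    by (simp add: amplify_compose is_projectionD(2)[OF P])
  moreover have "cinner (amplify P x) y = cinner x (amplify P y)" for x y
    by (simp add: cinner_ell2_def amplify.rep_eq ell2_map.rep_eq is_projectionD(4)[OF P])
  ultimately show ?thesis
    by (simp add: projections_def)
qed

text \<open>Lets projections of \<open>M\<close> serve as test projections in \<open>qdiam\<close>:
  \<open>amplify P\<close> is the elementary tensor of \<open>P\<close> with the identity, so it
  already lies in the span whose weak* closure is taken.\<close>

lemma amplify_in_projections_tensor:
  assumes "P \<in> projections M"
  shows "amplify P \<in> projections (tensor_B_ell2 M)"
proof -
  have P: "is_projection P" "P \<in> M"
    using assms by (simp_all add: projections_iff[of P M])
  let ?S = "{T :: 'a ell2 \<Rightarrow>\<^sub>L 'a ell2. T \<in> operators_on UNIV \<and>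
       (\<exists>A\<in>M. \<exists>B\<in>operators_on UNIV. \<forall>x s. T (tensor_vec x s) = tensor_vec (A x) (B s))}"
  have op: "amplify P \<in> operators_on UNIV"
    by (rule is_projectionD(1)[OF is_projection_amplify[OF P(1)]])
  have "amplify P \<in> ?S"
    using op P(2) id_in_operators_on_UNIV
    by (intro CollectI conjI bexI[of _ P] bexI[of _ id_blinfun])
      (simp_all add: amplify_tensor_vec[OF is_projectionD(1)[OF P(1)]])
  then have "amplify P \<in> cspan ?S"
    by (rule complex_vector.span_base)
  moreover have "amplify P \<in> topspace weakstar_topology"
    using op by (simp add: weakstar_topology_def topspace_pullback_topology)
  ultimately have "amplify P \<in> tensor_B_ell2 M"
    unfolding tensor_B_ell2_def in_closure_of by blast
  then show ?thesis
    using is_projection_amplify[OF P(1)] by (simp add: projections_iff[of _ "tensor_B_ell2 M"])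
qed

text \<open>A lower bound \<open>e\<close> on the distance, stated on \<open>H\<close> itself
  without infima or amplifications. The strict \<open>s < e\<close> makes this equivalent to the
  bound on the infimum.\<close>

definition separated ::
    "(real \<Rightarrow> ('a::complex_hilbert \<Rightarrow>\<^sub>L 'a) set) \<Rightarrow> real \<Rightarrow> ('a \<Rightarrow>\<^sub>L 'a) \<Rightarrow> ('a \<Rightarrow>\<^sub>L 'a) \<Rightarrow> bool" where
  "separated V e P Q \<longleftrightarrow> (\<forall>s A. 0 \<le> s \<longrightarrow> s < e \<longrightarrow> A \<in> V s \<longrightarrow> P o\<^sub>L A o\<^sub>L Q = 0)"

lemma separatedD: "separated V e P Q \<Longrightarrow> 0 \<le> s \<Longrightarrow> s < e \<Longrightarrow> A \<in> V s \<Longrightarrow> P o\<^sub>L A o\<^sub>L Q = 0"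
  by (auto simp: separated_def)

lemma separated_mono: "separated V e P Q \<Longrightarrow> d \<le> e \<Longrightarrow> separated V d P Q"
  by (auto simp: separated_def)

lemma le_qdist_amplify_iff:
  "ereal e \<le> qdist V (amplify P) (amplify Q) \<longleftrightarrow> separated V e P Q"
proof -
  have "ereal e \<le> qdist V (amplify P) (amplify Q) \<longleftrightarrow>
      (\<forall>t. 0 \<le> t \<and> (\<exists>A\<in>V t. P o\<^sub>L A o\<^sub>L Q \<noteq> 0) \<longrightarrow> e \<le> t)"
    unfolding qdist_def amplify_compose amplify_eq_0_iff le_Inf_iff
    by (auto simp flip: ereal_less_eq(3))
  then show ?thesis
    unfolding separated_def by (meson not_less)
qed

text \<open>The outer factors absorb both copies of \<open>R\<close> in a compressed operator, so
  the two metrics put \<open>P\<close> and \<open>Q\<close> to the same test.\<close>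

lemma separated_quotient_iff:
  assumes "P o\<^sub>L R = P" "R o\<^sub>L Q = Q"
  shows "separated (quotient_metric R V) e P Q \<longleftrightarrow> separated V e P Q"
proof -
  have "P o\<^sub>L (R o\<^sub>L A o\<^sub>L R) o\<^sub>L Q = P o\<^sub>L A o\<^sub>L Q" for A
    by (metis assms blinfun_compose_assoc)
  then show ?thesis
    by (fastforce simp: separated_def quotient_metric_def)
qed

text \<open>The case \<open>P = Q\<close> expresses a diameter bound. Two different projections are
  allowed because bounding the diameter of a join requires its off-diagonal corners.\<close>

definition controlled ::
    "('a::complex_hilbert \<Rightarrow>\<^sub>L 'a) set \<Rightarrow> ('a \<Rightarrow>\<^sub>L 'a) \<Rightarrow> ('a \<Rightarrow>\<^sub>L 'a) \<Rightarrow> bool" where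
  "controlled W P Q \<longleftrightarrow> (\<forall>A\<in>operators_on UNIV. P o\<^sub>L A o\<^sub>L Q \<in> W)"

lemma compose_rank_one_compose_eq_0:
  fixes P Q :: "'a::complex_hilbert \<Rightarrow>\<^sub>L 'a"
  assumes "P \<in> operators_on UNIV" "\<And>A. A \<in> operators_on UNIV \<Longrightarrow> P o\<^sub>L A o\<^sub>L Q = 0"
  shows "P = 0 \<or> Q = 0"
  using exists_rank_one_nonzero[of P Q] assms by blast

section \<open>Reflexive quantum metrics\<close>

locale reflexive_quantum_metric_space =
  fixes M :: "('a::complex_hilbert \<Rightarrow>\<^sub>L 'a) set"
    and V :: "real \<Rightarrow> ('a \<Rightarrow>\<^sub>L 'a) set"
  assumes vn: "von_neumann_algebra UNIV M"
    and qm: "quantum_metric UNIV M V"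
    and refl: "reflexive_metric UNIV V"
begin

section \<open>Closure properties of the metric and projections in \<open>M\<close>\<close>

lemma V_operator: "0 \<le> t \<Longrightarrow> A \<in> V t \<Longrightarrow> A \<in> operators_on UNIV"
  using qm unfolding quantum_metric_def by blast

lemma V_adj: "0 \<le> t \<Longrightarrow> A \<in> V t \<Longrightarrow> adj A \<in> V t"
  using qm unfolding quantum_metric_def by blast

lemma V_compose: "0 \<le> s \<Longrightarrow> 0 \<le> t \<Longrightarrow> A \<in> V s \<Longrightarrow> B \<in> V t \<Longrightarrow> A o\<^sub>L B \<in> V (s + t)"
  using qm unfolding quantum_metric_def by blast

lemma V_mono:
  assumes "0 \<le> s" "s \<le> t"
  shows "V s \<subseteq> V t"
proof (cases "s = t")
  case False
  have "V s = (\<Inter>u\<in>{s<..}. V u)"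
    using qm assms unfolding quantum_metric_def by blast
  then show ?thesis
    using False assms by auto
qed simp

lemma V_0: "V 0 = commutant UNIV M"
  using qm unfolding quantum_metric_def by blast

lemma M_bicommutant: "M = commutant UNIV (V 0)"
  using vn by (simp add: V_0 von_neumann_algebra_def)

lemma id_in_V: "0 \<le> t \<Longrightarrow> id_blinfun \<in> V t"
  using V_mono[of 0 t] by (auto simp: V_0 commutant_def id_in_operators_on_UNIV)

lemma id_in_M: "id_blinfun \<in> M"
  by (subst M_bicommutant) (simp add: commutant_def id_in_operators_on_UNIV)

lemma is_projection_M: "P \<in> projections M \<Longrightarrow> is_projection P"
  by (simp add: projections_iff[of P M])

lemma complement_in_M:
  assumes "P \<in> projections M"
  shows "id_blinfun - P \<in> projections M"
proof -
  have "csubspace M"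
    using vn by (simp add: von_neumann_algebra_def)
  then show ?thesis
    using assms
    by (auto simp: projections_iff[of _ M] is_projection_complement id_in_M
        intro: complex_vector.subspace_diff)
qed

text \<open>\<open>M\<close> is the commutant of \<open>V 0\<close>, so commutation with
  \<open>V 0\<close> suffices. Invariance of \<open>X\<close> passes to its closed span, and since
  \<open>V 0\<close> is closed under adjoints this span is reducing.\<close>

lemma span_proj_in_M:
  assumes X: "\<And>A x. A \<in> V 0 \<Longrightarrow> x \<in> X \<Longrightarrow> A x \<in> X"
  shows "span_proj X \<in> projections M"
proof -
  let ?E = "span_proj X"
  have E: "is_projection ?E"
    by (rule is_projection_span_proj)
  have inv: "A o\<^sub>L ?E = ?E o\<^sub>L A o\<^sub>L ?E" if A: "A \<in> V 0" for A
  proof -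
    have "((id_blinfun - ?E) o\<^sub>L A) o\<^sub>L ?E = 0"
    proof (rule compose_span_proj_eq_0)
      show "(id_blinfun - ?E) o\<^sub>L A \<in> operators_on UNIV"
        by (intro operators_on_UNIV_compose is_projectionD(1) is_projection_complement E
            V_operator[OF _ A]) simp
      show "((id_blinfun - ?E) o\<^sub>L A) x = 0" if "x \<in> X" for x
        using span_proj_fixes[OF X[OF A that]] by (simp add: blinfun.diff_left)
    qed
    then show ?thesis
      by (simp add: blinfun_compose_diff_left)
  qed
  have "?E o\<^sub>L A = A o\<^sub>L ?E" if A: "A \<in> V 0" for A
  proof -
    have op: "A \<in> operators_on UNIV" "adj A \<in> operators_on UNIV" "?E \<in> operators_on UNIV"
      using V_operator[OF _ A] V_operator[OF _ V_adj[OF _ A]] is_projectionD(1)[OF E] by simp_all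
    \<comment> \<open>Invariance under \<open>adj A\<close>, read through adjoints, supplies the
      second half of the commutation.\<close>
    have "adj (adj A o\<^sub>L ?E) = adj (?E o\<^sub>L adj A o\<^sub>L ?E)"
      using inv[OF V_adj[OF _ A]] by simp
    then have "?E o\<^sub>L A = ?E o\<^sub>L (A o\<^sub>L ?E)"
      using op by (simp add: adj_compose operators_on_UNIV_compose adj_adj is_projection_adj[OF E])
    then show ?thesis
      by (rule trans[OF _ inv[OF A, unfolded blinfun_compose_assoc, symmetric]])
  qed
  then have "?E \<in> M"
    by (subst M_bicommutant) (simp add: commutant_def is_projectionD(1)[OF E])
  then show ?thesis
    using E by (simp add: projections_iff[of _ M])
qed

lemma proj_join_in_M:
  assumes "S \<subseteq> projections M"
  shows "proj_join S \<in> projections M"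
  unfolding proj_join_eq_span_proj
proof (rule span_proj_in_M)
  fix A x assume A: "A \<in> V 0" and "x \<in> (\<Union>P\<in>S. range (blinfun_apply P))"
  then obtain P y where P: "P \<in> S" "x = P y"
    by blast
  then have "P \<in> M"
    using assms projections_iff by blast
  then have "A o\<^sub>L P = P o\<^sub>L A"
    using A by (simp add: V_0 commutant_def)
  then have "A x = P (A y)"
    by (metis P(2) blinfun_apply_blinfun_compose)
  then show "A x \<in> (\<Union>P\<in>S. range (blinfun_apply P))"
    using P(1) by blast
qed

text \<open>\<open>V s\<close> is self-adjoint, so applying the hypothesis to \<open>adj A\<close>
  and taking adjoints exchanges the two sides.\<close>

lemma compose_V_compose_commute:
  assumes "is_projection P" "is_projection Q" "0 \<le> s" "\<And>A. A \<in> V s \<Longrightarrow> P o\<^sub>L A o\<^sub>L Q = 0" "A \<in> V s"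
  shows "Q o\<^sub>L A o\<^sub>L P = 0"
proof -
  note ops = is_projectionD(1)[OF assms(1)] is_projectionD(1)[OF assms(2)] V_operator[OF assms(3,5)]
    V_operator[OF assms(3) V_adj[OF assms(3,5)]]
  have "adj (P o\<^sub>L adj A o\<^sub>L Q) = 0"
    using assms(4)[OF V_adj[OF assms(3,5)]] by (simp add: adj_zero)
  then show ?thesis
    using assms(1,2) ops
    by (simp add: adj_compose operators_on_UNIV_compose adj_adj is_projection_adj
        blinfun_compose_assoc)
qed

section \<open>Separation: symmetry, joins and dominating projections\<close>

lemma separated_commute:
  "is_projection P \<Longrightarrow> is_projection Q \<Longrightarrow> separated V e P Q \<Longrightarrow> separated V e Q P"
  unfolding separated_def using compose_V_compose_commute by metis

lemma separated_proj_join_right: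
  assumes P: "P \<in> operators_on UNIV" and "\<And>Q. Q \<in> S \<Longrightarrow> separated V e P Q"
  shows "separated V e P (proj_join S)"
  unfolding separated_def
proof (intro allI impI)
  fix s A assume s: "0 \<le> s" "s < e" and A: "A \<in> V s"
  show "P o\<^sub>L A o\<^sub>L proj_join S = 0"
    by (intro compose_proj_join_eq_0 operators_on_UNIV_compose P V_operator[OF s(1) A]
        separatedD[OF assms(2) s A])
qed

lemma separated_proj_join_left:
  assumes "S \<subseteq> projections UNIV" "is_projection P" "\<And>Q. Q \<in> S \<Longrightarrow> separated V e Q P"
  shows "separated V e (proj_join S) P"
proof (rule separated_commute[OF assms(2) is_projection_proj_join])
  show "separated V e P (proj_join S)"
  proof (rule separated_proj_join_right[OF is_projectionD(1)[OF assms(2)]])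
    fix Q assume "Q \<in> S"
    then show "separated V e P Q"
      using assms by (intro separated_commute[of Q P]) auto
  qed
qed

text \<open>\<open>G\<close> is the complement of the projection onto the closed span of all
  \<open>A (F x)\<close> with \<open>A\<close> in \<open>V t\<close>. Products of \<open>V 0\<close>
  with \<open>V t\<close> stay in \<open>V t\<close>, so this span is invariant under
  \<open>V 0\<close> and its projection lies in \<open>M\<close>; \<open>E\<close> annihilates the
  span.\<close>

lemma dominating_projection_in_M:
  assumes E: "is_projection E" and F: "is_projection F" and t: "0 \<le> t"
    and EF: "\<And>A. A \<in> V t \<Longrightarrow> E o\<^sub>L A o\<^sub>L F = 0"
  shows "\<exists>G\<in>projections M. E o\<^sub>L G = E \<and> (\<forall>A\<in>V t. G o\<^sub>L A o\<^sub>L F = 0)"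
proof -
  define X where "X = {blinfun_apply A (F x) | A x. A \<in> V t}"
  have "span_proj X \<in> projections M"
  proof (rule span_proj_in_M)
    fix B x assume B: "B \<in> V 0" and "x \<in> X"
    then obtain A y where A: "A \<in> V t" "x = A (F y)"
      by (auto simp: X_def)
    then have "B o\<^sub>L A \<in> V t"
      using V_compose[OF _ t B A(1)] by simp
    moreover have "B x = (B o\<^sub>L A) (F y)"
      using A by simp
    ultimately show "B x \<in> X"
      unfolding X_def by blast
  qed
  then have "id_blinfun - span_proj X \<in> projections M"
    by (rule complement_in_M)
  moreover have "E o\<^sub>L span_proj X = 0"
  proof (rule compose_span_proj_eq_0[OF is_projectionD(1)[OF E]])
    fix x assume "x \<in> X"
    then obtain A y where A: "A \<in> V t" "x = A (F y)"
      by (auto simp: X_def)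
    then show "E x = 0"
      using blinfun_eq_0D[OF EF[OF A(1)], of y] by simp
  qed
  then have "E o\<^sub>L (id_blinfun - span_proj X) = E"
    by (simp add: blinfun_compose_diff_right)
  moreover have "(id_blinfun - span_proj X) o\<^sub>L A o\<^sub>L F = 0" if "A \<in> V t" for A
  proof (rule blinfun_eqI)
    fix y
    have "A (F y) \<in> X"
      using that by (auto simp: X_def)
    then show "((id_blinfun - span_proj X) o\<^sub>L A o\<^sub>L F) y = blinfun_apply 0 y"
      by (simp add: blinfun.diff_left span_proj_fixes)
  qed
  ultimately show ?thesis
    by blast
qed

section \<open>Reflexivity tested on projections of \<open>M\<close>, and controlled pairs\<close>

lemma mem_V_iff:
  assumes "0 \<le> t"
  shows "B \<in> V t \<longleftrightarrow> B \<in> operators_on UNIV \<and> (\<forall>E F. is_projection E \<longrightarrow> is_projection F \<longrightarrow>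
    (\<forall>A\<in>V t. E o\<^sub>L A o\<^sub>L F = 0) \<longrightarrow> E o\<^sub>L B o\<^sub>L F = 0)"
proof -
  have "projections (operators_on UNIV) = (projections UNIV :: ('a \<Rightarrow>\<^sub>L 'a) set)"
    by (auto simp: projections_def)
  then show ?thesis
    using refl assms unfolding reflexive_metric_def reflexive_def by blast
qed

text \<open>Reflexivity tests \<open>B\<close> against all pairs of projections of B(H) that
  annihilate \<open>V t\<close>. Enlarging first one and then the other to a projection of
  \<open>M\<close>, with \<open>V t\<close> still annihilated, shows that pairs from
  \<open>M\<close> suffice.\<close>

lemma mem_VI:
  assumes "0 \<le> t" "B \<in> operators_on UNIV"
    "\<And>E F. E \<in> projections M \<Longrightarrow> F \<in> projections M \<Longrightarrow>
      (\<And>A. A \<in> V t \<Longrightarrow> E o\<^sub>L A o\<^sub>L F = 0) \<Longrightarrow> E o\<^sub>L B o\<^sub>L F = 0"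
  shows "B \<in> V t"
  unfolding mem_V_iff[OF assms(1)]
proof (intro conjI allI impI assms(2))
  fix E F assume E: "is_projection E" and F: "is_projection F" and "\<forall>A\<in>V t. E o\<^sub>L A o\<^sub>L F = 0"
  then obtain G where G: "G \<in> projections M" "E o\<^sub>L G = E" "\<And>A. A \<in> V t \<Longrightarrow> G o\<^sub>L A o\<^sub>L F = 0"
    using dominating_projection_in_M[OF E F assms(1)] by blast
  note G' = is_projection_M[OF G(1)]
  \<comment> \<open>Domination enlarges the left factor, so the sides are swapped before
    \<open>F\<close> is treated.\<close>
  have "\<And>A. A \<in> V t \<Longrightarrow> F o\<^sub>L A o\<^sub>L G = 0"
    using compose_V_compose_commute[OF G' F assms(1) G(3)] .
  then obtain H where H: "H \<in> projections M" "F o\<^sub>L H = F" "\<And>A. A \<in> V t \<Longrightarrow> H o\<^sub>L A o\<^sub>L G = 0"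
    using dominating_projection_in_M[OF F G' assms(1)] by blast
  note H' = is_projection_M[OF H(1)]
  have "H o\<^sub>L F = F"
    by (metis H(2) H' F adj_compose is_projectionD(1) is_projection_adj)
  moreover have "G o\<^sub>L B o\<^sub>L H = 0"
    using assms(3)[OF G(1) H(1)] compose_V_compose_commute[OF H' G' assms(1) H(3)] by blast
  ultimately show "E o\<^sub>L B o\<^sub>L F = 0"
    by (metis G(2) blinfun_compose_assoc blinfun_compose_zero)
qed

text \<open>All products \<open>(P X Q) C (Q' Y S)\<close> lie in \<open>V (a + s + b)\<close>. If
  \<open>E\<close> and \<open>F\<close> annihilate that set, primeness of B(H), used on both sides
  of the nonzero \<open>Q C Q'\<close>, forces \<open>E P = 0\<close> or \<open>S F = 0\<close>, so
  that the pair annihilates \<open>P B S\<close> as well.\<close>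

lemma controlled_trans:
  assumes P: "P \<in> projections M" and S: "S \<in> projections M"
    and Q: "Q \<in> projections M" and Q': "Q' \<in> projections M"
    and a: "0 \<le> a" "controlled (V a) P Q" and b: "0 \<le> b" "controlled (V b) Q' S"
    and C: "0 \<le> s" "C \<in> V s" "Q o\<^sub>L C o\<^sub>L Q' \<noteq> 0"
  shows "controlled (V (a + s + b)) P S"
  unfolding controlled_def
proof (intro ballI mem_VI)
  have ops: "P \<in> operators_on UNIV" "S \<in> operators_on UNIV"
    "Q o\<^sub>L C o\<^sub>L Q' \<in> operators_on UNIV"
    by (intro operators_on_UNIV_compose is_projectionD(1)[OF is_projection_M] P S Q Q'
        V_operator[OF C(1,2)])+
  fix B :: "'a \<Rightarrow>\<^sub>L 'a" assume B: "B \<in> operators_on UNIV"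
  show "P o\<^sub>L B o\<^sub>L S \<in> operators_on UNIV"
    by (intro operators_on_UNIV_compose B ops)
  fix E F assume E: "E \<in> projections M" and F: "F \<in> projections M"
    and EF: "\<And>A. A \<in> V (a + s + b) \<Longrightarrow> E o\<^sub>L A o\<^sub>L F = 0"
  have EP: "E o\<^sub>L P \<in> operators_on UNIV"
    by (intro operators_on_UNIV_compose is_projectionD(1)[OF is_projection_M] E P)
  have "(E o\<^sub>L P) o\<^sub>L X o\<^sub>L ((Q o\<^sub>L C o\<^sub>L Q') o\<^sub>L Y o\<^sub>L (S o\<^sub>L F)) = 0"
    if "X \<in> operators_on UNIV" "Y \<in> operators_on UNIV" for X Y
  proof -
    have "(P o\<^sub>L X o\<^sub>L Q) o\<^sub>L C o\<^sub>L (Q' o\<^sub>L Y o\<^sub>L S) \<in> V (a + s + b)"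
      using that a b C by (intro V_compose) (auto simp: controlled_def)
    from EF[OF this] show ?thesis
      by (simp add: blinfun_compose_assoc)
  qed
  then have "E o\<^sub>L P = 0 \<or> (\<forall>Y\<in>operators_on UNIV. (Q o\<^sub>L C o\<^sub>L Q') o\<^sub>L Y o\<^sub>L (S o\<^sub>L F) = 0)"
    using compose_rank_one_compose_eq_0[OF EP] by blast
  then have "E o\<^sub>L P = 0 \<or> S o\<^sub>L F = 0"
    using compose_rank_one_compose_eq_0[OF ops(3)] C(3) by blast
  then show "E o\<^sub>L (P o\<^sub>L B o\<^sub>L S) o\<^sub>L F = 0"
    by (metis blinfun_compose_assoc blinfun_compose_zero)
qed (use a b C in auto)

text \<open>What a cover of a quotient becomes in terms of \<open>M\<close> and \<open>V\<close>:
  separation replaces disjointness of neighbourhoods, and one constant \<open>d\<close> serves all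
  \<open>n + 1\<close> families.\<close>

definition controlled_cover ::
    "nat \<Rightarrow> real \<Rightarrow> real \<Rightarrow> (nat \<Rightarrow> ('a \<Rightarrow>\<^sub>L 'a) set) \<Rightarrow> ('a \<Rightarrow>\<^sub>L 'a) \<Rightarrow> bool" where
  "controlled_cover n e d \<U> R \<longleftrightarrow> 0 \<le> d \<and>
     (\<forall>i\<le>n. \<U> i \<subseteq> projections M \<and> pairwise (separated V e) (\<U> i) \<and>
        (\<forall>P\<in>\<U> i. controlled (V d) P P)) \<and>
     proj_join (\<Union>i\<le>n. \<U> i) = R"

lemma controlled_mono: "0 \<le> s \<Longrightarrow> s \<le> t \<Longrightarrow> controlled (V s) P Q \<Longrightarrow> controlled (V t) P Q"
  using V_mono unfolding controlled_def by blast

lemma controlled_commute: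
  assumes P: "is_projection P" and Q: "is_projection Q" and t: "0 \<le> t" and "controlled (V t) P Q"
  shows "controlled (V t) Q P"
  unfolding controlled_def
proof
  fix A :: "'a \<Rightarrow>\<^sub>L 'a" assume A: "A \<in> operators_on UNIV"
  note ops = A adj_in_operators_on_UNIV[OF A] is_projectionD(1)[OF P] is_projectionD(1)[OF Q]
  have "adj (P o\<^sub>L adj A o\<^sub>L Q) \<in> V t"
    using assms(4) ops(2) by (intro V_adj[OF t]) (simp add: controlled_def)
  also have "adj (P o\<^sub>L adj A o\<^sub>L Q) = Q o\<^sub>L A o\<^sub>L P"
    using ops by (simp add: adj_compose operators_on_UNIV_compose adj_adj is_projection_adj P Q
        blinfun_compose_assoc)
  finally show "Q o\<^sub>L A o\<^sub>L P \<in> V t" .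
qed

text \<open>If \<open>E\<close> and \<open>F\<close> annihilate \<open>V t\<close>, then
  \<open>E P = 0\<close> or \<open>Q F = 0\<close> for any two members \<open>P\<close>,
  \<open>Q\<close> of \<open>S\<close>. Hence one of \<open>E\<close>, \<open>F\<close> annihilates
  every member, and therefore the join.\<close>

lemma controlled_proj_join:
  assumes S: "S \<subseteq> projections M" and t: "0 \<le> t"
    and c: "\<And>P Q. P \<in> S \<Longrightarrow> Q \<in> S \<Longrightarrow> controlled (V t) P Q"
  shows "controlled (V t) (proj_join S) (proj_join S)"
  unfolding controlled_def
proof (intro ballI mem_VI t)
  let ?J = "proj_join S"
  note J = is_projection_proj_join[of S]
  fix B :: "'a \<Rightarrow>\<^sub>L 'a" assume B: "B \<in> operators_on UNIV"
  show "?J o\<^sub>L B o\<^sub>L ?J \<in> operators_on UNIV"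
    by (intro operators_on_UNIV_compose B is_projectionD(1) J)
  fix E F assume E: "E \<in> projections M" and F: "F \<in> projections M"
    and EF: "\<And>A. A \<in> V t \<Longrightarrow> E o\<^sub>L A o\<^sub>L F = 0"
  note E' = is_projection_M[OF E] and F' = is_projection_M[OF F]
  have "E o\<^sub>L P = 0 \<or> Q o\<^sub>L F = 0" if "P \<in> S" "Q \<in> S" for P Q
  proof (rule compose_rank_one_compose_eq_0)
    show "E o\<^sub>L P \<in> operators_on UNIV"
      using S that by (intro operators_on_UNIV_compose is_projectionD(1)[OF is_projection_M] E) auto
    fix A :: "'a \<Rightarrow>\<^sub>L 'a" assume "A \<in> operators_on UNIV"
    then have "P o\<^sub>L A o\<^sub>L Q \<in> V t"
      using c[OF that] by (simp add: controlled_def)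
    from EF[OF this] show "(E o\<^sub>L P) o\<^sub>L A o\<^sub>L (Q o\<^sub>L F) = 0"
      by (simp add: blinfun_compose_assoc)
  qed
  then consider "\<And>P. P \<in> S \<Longrightarrow> E o\<^sub>L P = 0" | "\<And>Q. Q \<in> S \<Longrightarrow> Q o\<^sub>L F = 0"
    by blast
  then have "E o\<^sub>L ?J = 0 \<or> ?J o\<^sub>L F = 0"
  proof cases
    case 1
    then show ?thesis
      using compose_proj_join_eq_0[OF is_projectionD(1)[OF E']] by blast
  next
    case 2
    have "F o\<^sub>L Q = 0" if "Q \<in> S" for Q
      using that S by (intro projection_product_zero_commute[OF _ F' 2] is_projection_M) auto
    then have "F o\<^sub>L ?J = 0"
      by (rule compose_proj_join_eq_0[OF is_projectionD(1)[OF F']])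
    then show ?thesis
      using projection_product_zero_commute[OF F' J] by blast
  qed
  then show "E o\<^sub>L (?J o\<^sub>L B o\<^sub>L ?J) o\<^sub>L F = 0"
    by (metis blinfun_compose_assoc blinfun_compose_zero)
qed

section \<open>Diameters and neighbourhoods in terms of control and separation\<close>

lemma qdiam_le:
  assumes "0 \<le> t" "controlled (V t) P P"
  shows "qdiam UNIV M V P \<le> ereal t"
proof -
  \<comment> \<open>The operator \<open>P o\<^sub>L A o\<^sub>L P\<close> itself lies in
    \<open>V t\<close>, so \<open>t\<close> is among the numbers whose infimum is the
    distance.\<close>
  have "qdist V Q R \<le> ereal t"
    if "A \<in> operators_on UNIV" "Q o\<^sub>L amplify (P o\<^sub>L A o\<^sub>L P) o\<^sub>L R \<noteq> 0" for Q R A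
    unfolding qdist_def
    using assms that by (intro Inf_lower) (auto simp: controlled_def)
  then show ?thesis
    using assms(1) by (auto simp: qdiam_def intro!: Sup_least)
qed

text \<open>The neighbourhood of \<open>P\<close> lies below \<open>E P\<close>, the projection onto
  the closed span of all \<open>A (P x)\<close> with \<open>A\<close> in \<open>V s\<close> and
  \<open>s < r\<close>. Orthogonality of \<open>E P\<close> and \<open>E Q\<close> is a triangle
  inequality: two displacements below \<open>r\<close> do not bridge a gap of
  \<open>2 * r\<close>.\<close>

lemma qnbhd_compose_eq_0:
  assumes P: "P \<in> projections M" and Q: "Q \<in> projections M"
    and sep: "separated V (2 * r) P Q"
  shows "qnbhd UNIV M V P r o\<^sub>L qnbhd UNIV M V Q r = 0"
proof -
  define X where "X P = {blinfun_apply A (blinfun_apply P x) | A x s. 0 \<le> s \<and> s < r \<and> A \<in> V s}"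
    for P :: "'a \<Rightarrow>\<^sub>L 'a"
  define E where "E P = span_proj (X P)" for P
  have E: "is_projection (E P)" for P
    unfolding E_def by (rule is_projection_span_proj)
  have E_fixes: "E P o\<^sub>L A o\<^sub>L P = A o\<^sub>L P" if "0 \<le> s" "s < r" "A \<in> V s" for P A s
  proof (rule blinfun_eqI)
    fix x
    have "A (P x) \<in> X P"
      unfolding X_def using that by blast
    then show "(E P o\<^sub>L A o\<^sub>L P) x = (A o\<^sub>L P) x"
      by (simp add: E_def span_proj_fixes)
  qed
  have E_zero: "B o\<^sub>L E P = 0" if B: "B \<in> operators_on UNIV"
    and 0: "\<And>s A. 0 \<le> s \<Longrightarrow> s < r \<Longrightarrow> A \<in> V s \<Longrightarrow> B o\<^sub>L A o\<^sub>L P = 0" for B P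
    unfolding E_def
  proof (rule compose_span_proj_eq_0[OF B])
    fix y assume "y \<in> X P"
    then obtain A x s where A: "0 \<le> s" "s < r" "A \<in> V s" "y = A (P x)"
      unfolding X_def by blast
    show "B y = 0"
      using blinfun_eq_0D[OF 0[OF A(1-3)], of x] A(4) by simp
  qed
  have E_M: "E P \<in> projections M" for P
    unfolding E_def
  proof (rule span_proj_in_M)
    fix B x assume B: "B \<in> V 0" and "x \<in> X P"
    then obtain A y s where A: "0 \<le> s" "s < r" "A \<in> V s" "x = A (P y)"
      unfolding X_def by blast
    then have "B o\<^sub>L A \<in> V s"
      using V_compose[OF _ A(1) B A(3)] by simp
    moreover have "B x = (B o\<^sub>L A) (P y)"
      using A by simp
    ultimately show "B x \<in> X P"
      unfolding X_def using A(1,2) by blast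
  qed
  have nbhd: "is_projection (qnbhd UNIV M V P r)"
    "qnbhd UNIV M V P r o\<^sub>L E P = qnbhd UNIV M V P r" if P: "P \<in> projections M" for P
  proof -
    define J where "J = proj_join {Q \<in> projections M. ereal r \<le> qdist V (amplify P) (amplify Q)}"
    have n: "qnbhd UNIV M V P r = id_blinfun - J"
      by (simp add: qnbhd_def J_def proj_onto_UNIV)
    then show "is_projection (qnbhd UNIV M V P r)"
      by (simp add: J_def is_projection_complement is_projection_proj_join)
    \<comment> \<open>The complement of \<open>E P\<close> has distance at least \<open>r\<close>
      from \<open>P\<close>, so it is one of the projections joined in \<open>J\<close>.\<close>
    have "separated V r (id_blinfun - E P) P"
      unfolding separated_def by (simp add: blinfun_compose_diff_left E_fixes)
    then have "separated V r P (id_blinfun - E P)"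
      by (rule separated_commute[OF is_projection_complement[OF E] is_projection_M[OF P]])
    then have "J o\<^sub>L (id_blinfun - E P) = id_blinfun - E P"
      unfolding J_def
      by (intro proj_join_absorbs) (simp add: complement_in_M E_M le_qdist_amplify_iff)
    then show "qnbhd UNIV M V P r o\<^sub>L E P = qnbhd UNIV M V P r"
      by (simp add: n blinfun_compose_diff_left blinfun_compose_diff_right algebra_simps)
  qed
  have Q_E: "Q o\<^sub>L B o\<^sub>L E P = 0" if B: "0 \<le> s" "s < r" "B \<in> V s" for s B
  proof (rule E_zero)
    show "Q o\<^sub>L B \<in> operators_on UNIV"
      by (intro operators_on_UNIV_compose is_projectionD(1) is_projection_M Q V_operator[OF B(1,3)])
    fix s' A assume A: "0 \<le> s'" "s' < r" "A \<in> V s'"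
    have "separated V (2 * r) Q P"
      by (rule separated_commute[OF is_projection_M[OF P] is_projection_M[OF Q] sep])
    then have "Q o\<^sub>L (B o\<^sub>L A) o\<^sub>L P = 0"
      by (rule separatedD[of V "2 * r" Q P "s + s'"])
        (use A B V_compose[OF B(1) A(1) B(3) A(3)] in auto)
    then show "Q o\<^sub>L B o\<^sub>L A o\<^sub>L P = 0"
      by (simp add: blinfun_compose_assoc)
  qed
  have "E P o\<^sub>L E Q = 0"
  proof (rule E_zero[OF is_projectionD(1)[OF E]])
    fix s A assume A: "0 \<le> s" "s < r" "A \<in> V s"
    show "E P o\<^sub>L A o\<^sub>L Q = 0"
      by (rule compose_V_compose_commute[OF is_projection_M[OF Q] E A(1) Q_E[OF A(1,2)] A(3)])
  qed
  moreover have "E Q o\<^sub>L qnbhd UNIV M V Q r = qnbhd UNIV M V Q r"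
    by (metis adj_compose E is_projectionD(1) is_projection_adj nbhd[OF Q])
  ultimately show ?thesis
    by (metis nbhd(2)[OF P] blinfun_compose_assoc blinfun_compose_zero)
qed

end

section \<open>Metric quotients and the union theorem\<close>

locale metric_quotient = reflexive_quantum_metric_space +
  fixes R :: "'a::complex_hilbert \<Rightarrow>\<^sub>L 'a"
  assumes central: "central_projection M R"
begin

abbreviation "N \<equiv> quotient_algebra R M"
abbreviation "W \<equiv> quotient_metric R V"

section \<open>Transfer between a metric quotient and the whole space\<close>

lemma R_projection: "is_projection R"
  using central by (auto simp: central_projection_def dest: is_projection_M)

lemma R_commute: "A \<in> M \<Longrightarrow> R o\<^sub>L A = A o\<^sub>L R"
  using central by (simp add: central_projection_def)

text \<open>Centrality puts \<open>R\<close> in the commutant too, so multiplication by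
  \<open>R\<close> on either side maps \<open>V t\<close> into itself for
  \<open>t \<ge> 0\<close>.\<close>

lemma R_in_V: "R \<in> V 0"
  using R_projection R_commute by (simp add: V_0 commutant_def is_projectionD(1))

lemma projection_quotientD:
  assumes "P \<in> projections N"
  shows "P \<in> projections M" "R o\<^sub>L P = P" "P o\<^sub>L R = P"
proof -
  have P: "is_projection P" "P \<in> N"
    using assms projections_iff by blast+
  then obtain A where A: "A \<in> M" "P = R o\<^sub>L A"
    by (auto simp: quotient_algebra_def)
  have "R \<in> M"
    using central projections_iff unfolding central_projection_def by blast
  then have "P \<in> M"
    using vn A unfolding von_neumann_algebra_def by blast
  with P(1) show "P \<in> projections M"
    using projections_iff by blast
  show RP: "R o\<^sub>L P = P"
    by (simp add: A(2) is_projectionD(2)[OF R_projection] flip: blinfun_compose_assoc)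
  show "P o\<^sub>L R = P"
    using R_commute[OF \<open>P \<in> M\<close>] RP by simp
qed

lemma compress_projection:
  assumes "P \<in> projections M"
  shows "R o\<^sub>L P \<in> projections N" "R o\<^sub>L P = P o\<^sub>L R"
proof -
  note P = is_projection_M[OF assms]
  have "P \<in> M"
    using assms projections_iff by blast
  then show comm: "R o\<^sub>L P = P o\<^sub>L R"
    by (rule R_commute)
  have "R o\<^sub>L P \<in> operators_on UNIV"
    by (intro operators_on_UNIV_compose is_projectionD(1) P R_projection)
  moreover have "(R o\<^sub>L P) o\<^sub>L (R o\<^sub>L P) = R o\<^sub>L P"
    by (metis blinfun_compose_assoc comm is_projectionD(2)[OF P] is_projectionD(2)[OF R_projection])
  moreover have "cinner ((R o\<^sub>L P) x) y = cinner x ((R o\<^sub>L P) y)" for x y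
  proof -
    have "cinner ((R o\<^sub>L P) x) y = cinner x ((P o\<^sub>L R) y)"
      by (simp add: is_projectionD(4)[OF P] is_projectionD(4)[OF R_projection])
    then show ?thesis
      by (simp only: comm)
  qed
  moreover have "R o\<^sub>L P \<in> N"
    using \<open>P \<in> M\<close> by (simp add: quotient_algebra_def)
  ultimately show "R o\<^sub>L P \<in> projections N"
    by (simp add: projections_def)
qed

text \<open>Makes compressed operators admissible in the diameters of the quotient, whose operators
  act on the range of \<open>R\<close>.\<close>

lemma compress_in_operators_on_range:
  assumes "A \<in> operators_on UNIV"
  shows "R o\<^sub>L A o\<^sub>L R \<in> operators_on (range (blinfun_apply R))"
proof -
  have "R x = 0" if "\<forall>y\<in>range (blinfun_apply R). cinner x y = 0" for x
  proof -
    have "cinner (R x) (R x) = cinner x (R (R x))"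
      by (rule is_projectionD(4)[OF R_projection])
    also have "\<dots> = 0"
      using that by blast
    finally show ?thesis
      by (rule cinner_self_eq_0)
  qed
  moreover have "R o\<^sub>L A o\<^sub>L R \<in> operators_on UNIV"
    by (intro operators_on_UNIV_compose is_projectionD(1) R_projection assms)
  ultimately show ?thesis
    unfolding operators_on_UNIV_iff by (auto simp: operators_on_def)
qed

text \<open>The neighbourhood of \<open>Q\<close> in the quotient is \<open>R - J Q\<close>, and it
  fixes \<open>R A Q\<close> whenever \<open>A\<close> is in \<open>V s\<close> with
  \<open>s < e\<close>. As the neighbourhood of \<open>P\<close> dominates \<open>P\<close>, the
  operator \<open>P A Q\<close> factors through the product of both neighbourhoods, which is
  zero.\<close>

lemma separated_of_qnbhd_disjoint:
  assumes P: "P \<in> projections N" and Q: "Q \<in> projections N" and e: "0 < e"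
    and disj: "qnbhd (range R) N W P e o\<^sub>L qnbhd (range R) N W Q e = 0"
  shows "separated V e P Q"
proof -
  define J where "J P = proj_join {Q \<in> projections N. ereal e \<le> qdist W (amplify P) (amplify Q)}"
    for P
  have n: "qnbhd (range R) N W P e = R - J P" for P
    by (simp add: qnbhd_def J_def proj_onto_range[OF R_projection])
  have J: "is_projection (J P)" for P
    by (simp add: J_def is_projection_proj_join)
  have JRA: "J P o\<^sub>L R o\<^sub>L A o\<^sub>L P = 0" if P: "P \<in> projections N" and A: "0 \<le> s" "s < e" "A \<in> V s"
    for P A s
  proof -
    note P' = projection_quotientD[OF P] and P'' = is_projection_M[OF projection_quotientD(1)[OF P]]
    have RA: "R o\<^sub>L A \<in> V s" if "A \<in> V s" for A
      using V_compose[OF _ A(1) R_in_V that] by simp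
    have AR: "A o\<^sub>L R \<in> V s" if "A \<in> V s" for A
      using V_compose[OF A(1) _ that R_in_V] by simp
    have "P o\<^sub>L A o\<^sub>L J P = 0" if A': "A \<in> V s" for A
      unfolding J_def
    proof (rule compose_proj_join_eq_0)
      show "P o\<^sub>L A \<in> operators_on UNIV"
        by (intro operators_on_UNIV_compose is_projectionD(1) P'' V_operator[OF A(1) A'])
      fix Q assume "Q \<in> {Q \<in> projections N. ereal e \<le> qdist W (amplify P) (amplify Q)}"
      then have Q: "Q \<in> projections N" "separated W e P Q"
        by (auto simp: le_qdist_amplify_iff)
      then have "separated V e P Q"
        using separated_quotient_iff[OF P'(3) projection_quotientD(2)[OF Q(1)]] by blast
      then show "P o\<^sub>L A o\<^sub>L Q = 0"
        using A(1,2) A' by (rule separatedD)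
    qed
    from compose_V_compose_commute[OF P'' J A(1) this RA[OF A(3)]] show ?thesis
      by (simp add: blinfun_compose_assoc)
  qed
  have R_fixes: "(R - J P) o\<^sub>L (R o\<^sub>L A o\<^sub>L P) = R o\<^sub>L A o\<^sub>L P"
    if "P \<in> projections N" "0 \<le> s" "s < e" "A \<in> V s" for P A s
    using JRA[OF that] is_projectionD(2)[OF R_projection]
    by (simp add: blinfun_compose_diff_left flip: blinfun_compose_assoc)
  \<comment> \<open>Positivity of \<open>e\<close> admits the identity at parameter 0, so
    \<open>P\<close> lies below its own neighbourhood.\<close>
  have JP: "J P o\<^sub>L P = 0"
    using JRA[OF P _ e id_in_V] projection_quotientD(2)[OF P] by (simp add: blinfun_compose_assoc)
  have "P o\<^sub>L J P = 0"
    by (rule projection_product_zero_commute[OF J is_projection_M JP])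
      (rule projection_quotientD(1)[OF P])
  then have PR: "P o\<^sub>L (R - J P) = P"
    by (simp add: blinfun_compose_diff_right projection_quotientD(3)[OF P])
  show ?thesis
    unfolding separated_def
  proof (intro allI impI)
    fix s A assume A: "0 \<le> s" "s < e" "A \<in> V s"
    have "P o\<^sub>L A o\<^sub>L Q = P o\<^sub>L (R o\<^sub>L A o\<^sub>L Q)"
      by (metis blinfun_compose_assoc projection_quotientD(3)[OF P])
    also have "\<dots> = (P o\<^sub>L (R - J P)) o\<^sub>L ((R - J Q) o\<^sub>L (R o\<^sub>L A o\<^sub>L Q))"
      by (simp only: PR R_fixes[OF Q A])
    also have "\<dots> = P o\<^sub>L ((R - J P) o\<^sub>L (R - J Q)) o\<^sub>L (R o\<^sub>L A o\<^sub>L Q)"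
      by (simp only: blinfun_compose_assoc)
    also have "\<dots> = 0"
      using disj by (simp add: n)
    finally show "P o\<^sub>L A o\<^sub>L Q = 0" .
  qed
qed

text \<open>If \<open>E\<close> and \<open>F\<close> from \<open>M\<close> annihilate
  \<open>V t\<close> but not \<open>P B P\<close>, their compressions by \<open>R\<close> are test
  projections for the diameter of \<open>P\<close> in the quotient and have distance at least
  \<open>t\<close>, against \<open>d < t\<close>.\<close>

lemma controlled_of_qdiam:
  assumes P: "P \<in> projections N" and d: "qdiam (range R) N W P \<le> ereal d" and t: "0 \<le> t" "d < t"
  shows "controlled (V t) P P"
  unfolding controlled_def
proof (intro ballI mem_VI t(1))
  note P' = projection_quotientD[OF P] and P'' = is_projection_M[OF projection_quotientD(1)[OF P]]
  fix B :: "'a \<Rightarrow>\<^sub>L 'a" assume B: "B \<in> operators_on UNIV"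
  show "P o\<^sub>L B o\<^sub>L P \<in> operators_on UNIV"
    by (intro operators_on_UNIV_compose is_projectionD(1) P'' B)
  fix E F assume E: "E \<in> projections M" and F: "F \<in> projections M"
    and EF: "\<And>A. A \<in> V t \<Longrightarrow> E o\<^sub>L A o\<^sub>L F = 0"
  note E' = compress_projection[OF E] and F' = compress_projection[OF F]
  show "E o\<^sub>L (P o\<^sub>L B o\<^sub>L P) o\<^sub>L F = 0"
  proof (rule ccontr)
    assume nz: "E o\<^sub>L (P o\<^sub>L B o\<^sub>L P) o\<^sub>L F \<noteq> 0"
    have "(R o\<^sub>L E) o\<^sub>L (P o\<^sub>L (R o\<^sub>L B o\<^sub>L R) o\<^sub>L P) o\<^sub>L (R o\<^sub>L F) = E o\<^sub>L (P o\<^sub>L B o\<^sub>L P) o\<^sub>L F"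
    proof -
      have "R o\<^sub>L (P o\<^sub>L X) = P o\<^sub>L X" "P o\<^sub>L (R o\<^sub>L X) = P o\<^sub>L X" for X :: "'a \<Rightarrow>\<^sub>L 'a"
        using P'(2,3) by (metis blinfun_compose_assoc)+
      then show ?thesis
        unfolding E'(2) by (simp add: blinfun_compose_assoc)
    qed
    then have "amplify (R o\<^sub>L E) o\<^sub>L amplify (P o\<^sub>L (R o\<^sub>L B o\<^sub>L R) o\<^sub>L P) o\<^sub>L amplify (R o\<^sub>L F) \<noteq> 0"
      using nz by (simp add: amplify_compose amplify_eq_0_iff)
    moreover have "P \<noteq> 0"
      using nz by auto
    ultimately have "qdist W (amplify (R o\<^sub>L E)) (amplify (R o\<^sub>L F)) \<le> qdiam (range R) N W P"
      unfolding qdiam_def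
      using amplify_in_projections_tensor[OF E'(1)] amplify_in_projections_tensor[OF F'(1)]
        compress_in_operators_on_range[OF B]
      by (simp only: if_False) (intro Sup_upper, blast)
    moreover have "separated W t (R o\<^sub>L E) (R o\<^sub>L F)"
    proof -
      have "separated V t (R o\<^sub>L E) (R o\<^sub>L F)"
        unfolding separated_def
      proof (intro allI impI)
        fix s A assume A: "0 \<le> s" "s < t" "A \<in> V s"
        have "A o\<^sub>L R \<in> V s"
          using V_compose[OF A(1) _ A(3) R_in_V] by simp
        then have "A o\<^sub>L R \<in> V t"
          using V_mono[OF A(1), of t] A(2) by auto
        from EF[OF this] show "(R o\<^sub>L E) o\<^sub>L A o\<^sub>L (R o\<^sub>L F) = 0"
          by (simp add: blinfun_compose_assoc)
      qed
      then show ?thesis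
        by (subst separated_quotient_iff)
          (simp_all add: projection_quotientD(2)[OF F'(1)] projection_quotientD(3)[OF E'(1)])
    qed
    then have "ereal t \<le> qdist W (amplify (R o\<^sub>L E)) (amplify (R o\<^sub>L F))"
      by (simp add: le_qdist_amplify_iff)
    ultimately have "ereal t \<le> ereal d"
      using d by (meson order_trans)
    with t(2) show False
      by simp
  qed
qed

lemma quotient_cover:
  assumes asd: "asdim_le (range R) N W n" and e: "0 < e"
  shows "\<exists>\<U> d. controlled_cover n e d \<U> R"
proof -
  obtain \<U> :: "nat \<Rightarrow> ('a \<Rightarrow>\<^sub>L 'a) set" where
    *: "\<forall>i\<le>n. \<U> i \<subseteq> projections N \<and> uniformly_bounded_family (range R) N W (\<U> i) \<and>
      disjoint_family_at (range R) N W e (\<U> i)"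
    and cov: "is_cover (range R) (\<Union>i\<le>n. \<U> i)"
    using asd[unfolded asdim_le_def, rule_format, OF e] by (elim exE conjE) (rule that)
  have U: "\<U> i \<subseteq> projections N" and bdd: "uniformly_bounded_family (range R) N W (\<U> i)"
    and disj: "disjoint_family_at (range R) N W e (\<U> i)" if "i \<le> n" for i
    using * that by simp_all
  have "\<exists>D>0. \<forall>P\<in>\<U> i. qdiam (range R) N W P \<le> ereal D" if "i \<le> n" for i
    using bdd[OF that] unfolding uniformly_bounded_family_def by (auto simp: SUP_le_iff)
  then obtain D where D: "\<And>i. i \<le> n \<Longrightarrow> 0 < D i"
      "\<And>i P. i \<le> n \<Longrightarrow> P \<in> \<U> i \<Longrightarrow> qdiam (range R) N W P \<le> ereal (D i)"
    by metis
  \<comment> \<open>The sum dominates each \<open>D i\<close>, and the added 1 provides the strict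
    inequality required by \<open>controlled_of_qdiam\<close>.\<close>
  define d where "d = (\<Sum>i\<le>n. D i) + 1"
  have sum_nonneg: "0 \<le> (\<Sum>i\<le>n. D i)"
    using D(1) by (intro sum_nonneg) (auto intro: less_imp_le)
  have "D i < d" if "i \<le> n" for i
  proof -
    have "D i \<le> (\<Sum>i\<le>n. D i)"
      using that D(1) by (intro member_le_sum) (auto intro: less_imp_le)
    then show ?thesis
      by (simp add: d_def)
  qed
  then have "controlled (V d) P P" if "i \<le> n" "P \<in> \<U> i" for i P
    using controlled_of_qdiam[OF _ D(2)[OF that]] U that sum_nonneg by (force simp: d_def)
  moreover have "pairwise (separated V e) (\<U> i)" if "i \<le> n" for i
    using disj[OF that] U[OF that] e
    unfolding disjoint_family_at_def pairwise_def by (blast intro: separated_of_qnbhd_disjoint)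
  moreover have "\<U> i \<subseteq> projections M" if "i \<le> n" for i
    using U[OF that] projection_quotientD(1) by blast
  moreover have "proj_join (\<Union>i\<le>n. \<U> i) = R"
    using cov by (simp add: is_cover_def proj_onto_range[OF R_projection])
  ultimately show ?thesis
    using sum_nonneg by (intro exI[of _ \<U>] exI[of _ d]) (simp add: controlled_cover_def d_def)
qed

end

section \<open>Merging two covers\<close>

context reflexive_quantum_metric_space
begin

text \<open>Each member \<open>W\<close> of \<W> is replaced by its join \<open>T W\<close> with the
  nearby members of \<U>; those near no \<open>W\<close> are kept. The separation
  \<open>2 * e + d1\<close> prevents a member of \<U> from being near two different
  \<open>W\<close>, which keeps the joins \<open>e\<close>-separated.\<close>

lemma saturated_union:
  assumes e: "0 < e" and d1: "0 \<le> d1" and d2: "0 \<le> d2"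
    and U: "\<U> \<subseteq> projections M" "pairwise (separated V e) \<U>" "\<And>P. P \<in> \<U> \<Longrightarrow> controlled (V d1) P P"
    and W: "\<W> \<subseteq> projections M" "pairwise (separated V (2 * e + d1)) \<W>"
      "\<And>P. P \<in> \<W> \<Longrightarrow> controlled (V d2) P P"
  shows "\<exists>\<X>\<subseteq>projections M. pairwise (separated V e) \<X> \<and>
    (\<forall>P\<in>\<X>. controlled (V (2 * (d1 + e + d2))) P P) \<and> (\<forall>P\<in>\<U> \<union> \<W>. \<exists>Q\<in>\<X>. Q o\<^sub>L P = P)"
proof -
  \<comment> \<open>\<open>k\<close> accounts for passing from a nearby member of \<U> to
    \<open>W\<close>: size \<open>d1\<close>, a gap below \<open>e\<close>, size \<open>d2\<close>.
    Two nearby members are linked through \<open>W\<close>, at cost \<open>2 * k\<close>.\<close>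
  define k where "k = d1 + e + d2"
  define near where "near W = {U \<in> \<U>. \<not> separated V e U W}" for W
  define far where "far = {U \<in> \<U>. \<forall>W\<in>\<W>. separated V e U W}"
  define T where "T W = proj_join (insert W (near W))" for W
  have UM: "P \<in> projections M" "is_projection P" if "P \<in> \<U>" for P
    using U(1) that is_projection_M by auto
  have WM: "P \<in> projections M" "is_projection P" if "P \<in> \<W>" for P
    using W(1) that is_projection_M by auto
  have nearU: "P \<in> \<U>" if "P \<in> near W" for P W
    using that by (simp add: near_def)
  have k: "0 \<le> k" "d2 \<le> 2 * k" "k \<le> 2 * k" "d1 \<le> 2 * k"
    using e d1 d2 by (simp_all add: k_def)
  have near_controlled: "controlled (V k) P W" if WP: "W \<in> \<W>" "P \<in> near W" for P W
  proof -
    obtain s A where A: "0 \<le> s" "s < e" "A \<in> V s" "P o\<^sub>L A o\<^sub>L W \<noteq> 0"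
      using WP(2) by (auto simp: near_def separated_def)
    have "controlled (V (d1 + s + d2)) P W"
      using controlled_trans[OF UM(1) WM(1) UM(1) WM(1) d1 U(3) d2 W(3) A(1,3,4)] WP nearU by blast
    then show ?thesis
      by (rule controlled_mono[rotated 2]) (use A d1 d2 in \<open>auto simp: k_def\<close>)
  qed
  have near_near: "controlled (V (2 * k)) P Q" if "W \<in> \<W>" "P \<in> near W" "Q \<in> near W" for P Q W
  proof -
    \<comment> \<open>Zero is separated from everything. As \<open>W\<close> is nonzero, the
      identity in \<open>V 0\<close> links it to itself at no cost.\<close>
    have "W \<noteq> 0"
      using that(2) by (auto simp: near_def separated_def)
    then have "W o\<^sub>L id_blinfun o\<^sub>L W \<noteq> 0"
      by (simp add: is_projectionD(2)[OF WM(2)[OF that(1)]])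
    moreover have "controlled (V k) W Q"
      by (rule controlled_commute[OF UM(2)[OF nearU[OF that(3)]] WM(2)[OF that(1)] k(1)
            near_controlled[OF that(1,3)]])
    ultimately have "controlled (V (k + 0 + k)) P Q"
      using controlled_trans[of P Q W W k k 0 id_blinfun] that near_controlled[OF that(1,2)]
        UM(1) WM(1) nearU k(1) id_in_V by blast
    then show ?thesis
      by simp
  qed
  have sat_controlled: "controlled (V (2 * k)) (T W) (T W)" if "W \<in> \<W>" for W
    unfolding T_def
  proof (rule controlled_proj_join)
    show "insert W (near W) \<subseteq> projections M"
      using that UM WM nearU by blast
    show "0 \<le> 2 * k"
      using k by simp
    fix P Q assume P: "P \<in> insert W (near W)" and Q: "Q \<in> insert W (near W)"
    have "controlled (V (2 * k)) W W"
      using controlled_mono[OF d2 k(2) W(3)[OF that]] .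
    moreover have "controlled (V (2 * k)) P' W" "controlled (V (2 * k)) W P'" if P': "P' \<in> near W" for P'
      using controlled_mono[OF k(1,3) near_controlled[OF \<open>W \<in> \<W>\<close> P']]
        controlled_commute[OF UM(2)[OF nearU[OF P']] WM(2)[OF \<open>W \<in> \<W>\<close>] _ ] k by auto
    ultimately show "controlled (V (2 * k)) P Q"
      using P Q near_near[OF that] by blast
  qed
  have near_separated: "separated V e P W'" if WW: "W \<in> \<W>" "W' \<in> \<W>" "W \<noteq> W'" and P: "P \<in> near W"
    for P W W'
  proof (rule ccontr)
    \<comment> \<open>Passing from \<open>W\<close> to \<open>W'\<close> through \<open>P\<close> costs less than \<open>e + d1 + e\<close>.\<close>
    assume "\<not> separated V e P W'"
    then obtain s' B where B: "0 \<le> s'" "s' < e" "B \<in> V s'" "P o\<^sub>L B o\<^sub>L W' \<noteq> 0"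
      by (auto simp: separated_def)
    note P' = UM[OF nearU[OF P]] and W1 = WM[OF WW(1)]
    have "\<not> separated V e W P"
      using P separated_commute[OF W1(2) P'(2)] by (auto simp: near_def)
    then obtain s A where A: "0 \<le> s" "s < e" "A \<in> V s" "W o\<^sub>L A o\<^sub>L P \<noteq> 0"
      by (auto simp: separated_def)
    have "W o\<^sub>L A o\<^sub>L P \<in> operators_on UNIV"
      by (intro operators_on_UNIV_compose is_projectionD(1) P' W1 V_operator[OF A(1,3)])
    \<comment> \<open>By primeness of B(H), some \<open>X\<close> connects the two nonzero legs at
      \<open>P\<close> with a nonzero product.\<close>
    then obtain X where X: "X \<in> operators_on UNIV"
      and nz: "(W o\<^sub>L A o\<^sub>L P) o\<^sub>L X o\<^sub>L (P o\<^sub>L B o\<^sub>L W') \<noteq> 0"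
      using exists_rank_one_nonzero[of "W o\<^sub>L A o\<^sub>L P" "P o\<^sub>L B o\<^sub>L W'"] A(4) B(4) by blast
    have "P o\<^sub>L X o\<^sub>L P \<in> V d1"
      using U(3)[OF nearU[OF P]] X by (simp add: controlled_def)
    then have "A o\<^sub>L (P o\<^sub>L X o\<^sub>L P) o\<^sub>L B \<in> V (s + d1 + s')"
      using A B d1 by (intro V_compose) auto
    moreover have "separated V (2 * e + d1) W W'"
      using W(2) WW by (simp add: pairwise_def)
    ultimately have "W o\<^sub>L (A o\<^sub>L (P o\<^sub>L X o\<^sub>L P) o\<^sub>L B) o\<^sub>L W' = 0"
      using A B d1 by (intro separatedD[of V "2 * e + d1" W W' "s + d1 + s'"]) auto
    with nz show False
      by (simp add: blinfun_compose_assoc)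
  qed
  have SM: "insert W (near W) \<subseteq> projections M" if "W \<in> \<W>" for W
    using that UM WM nearU by blast
  have S_proj: "insert W (near W) \<subseteq> projections UNIV" if "W \<in> \<W>" for W
    using SM[OF that] is_projection_M by blast
  have S_separated: "separated V e P Q"
    if WW: "W \<in> \<W>" "W' \<in> \<W>" "W \<noteq> W'" and P: "P \<in> insert W (near W)" and Q: "Q \<in> insert W' (near W')"
    for P Q W W'
  proof -
    have P': "is_projection P" and Q': "is_projection Q"
      using S_proj WW P Q by blast+
    consider "P = W" "Q = W'" | "P \<in> near W" "Q = W'" | "P = W" "Q \<in> near W'" | "P \<in> near W" "Q \<in> near W'"
      using P Q by blast
    then show ?thesis
    proof cases
      case 1
      then show ?thesis
        using separated_mono[of V "2 * e + d1" W W' e] W(2) WW e d1 by (simp add: pairwise_def)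
    next
      case 2
      then show ?thesis
        using near_separated[OF WW] by blast
    next
      case 3
      then have "separated V e Q P"
        using near_separated[OF WW(2,1)] WW(3) by blast
      then show ?thesis
        by (rule separated_commute[OF Q' P'])
    next
      case 4
      \<comment> \<open>\<open>P\<close> is separated from \<open>W'\<close> and \<open>Q\<close> is
        not, so the separation within \<U> applies to them.\<close>
      have "P \<noteq> Q"
        using near_separated[OF WW 4(1)] 4(2) by (auto simp: near_def)
      then show ?thesis
        using U(2) 4 nearU by (auto simp: pairwise_def)
    qed
  qed
  have T_M: "T W \<in> projections M" if "W \<in> \<W>" for W
    unfolding T_def by (rule proj_join_in_M[OF SM[OF that]])
  have T_right: "separated V e P (T W)" if "is_projection P" "\<And>Q. Q \<in> insert W (near W) \<Longrightarrow> separated V e P Q"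
    for P W
    unfolding T_def by (rule separated_proj_join_right[OF is_projectionD(1)]) (use that in auto)
  have T_T: "separated V e (T W) (T W')" if WW: "W \<in> \<W>" "W' \<in> \<W>" "W \<noteq> W'" for W W'
    unfolding T_def[of W]
  proof (rule separated_proj_join_left[OF S_proj[OF WW(1)] is_projection_M[OF T_M[OF WW(2)]]])
    fix P assume P: "P \<in> insert W (near W)"
    then have "is_projection P"
      using S_proj[OF WW(1)] by blast
    then show "separated V e P (T W')"
      using S_separated[OF WW P] by (intro T_right)
  qed
  have far_T: "separated V e P (T W)" if "P \<in> far" "W \<in> \<W>" for P W
  proof (rule T_right)
    show "is_projection P"
      using that UM by (simp add: far_def)
    fix Q assume Q: "Q \<in> insert W (near W)"
    show "separated V e P Q"
    proof (cases "Q = W")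
      case True
      then show ?thesis
        using that by (simp add: far_def)
    next
      case False
      with Q have "Q \<in> near W"
        by simp
      \<comment> \<open>\<open>Q\<close> is near \<open>W\<close> while \<open>P\<close> is
        separated from it, so the two differ.\<close>
      then have "Q \<in> \<U>" "P \<in> \<U>" "P \<noteq> Q"
        using that by (auto simp: near_def far_def)
      then show ?thesis
        using U(2) by (simp add: pairwise_def)
    qed
  qed
  have T_far: "separated V e (T W) P" if "P \<in> far" "W \<in> \<W>" for P W
    by (rule separated_commute[OF _ is_projection_M[OF T_M[OF that(2)]] far_T[OF that]])
      (use that UM in \<open>simp add: far_def\<close>)
  define \<X> where "\<X> = T ` \<W> \<union> far"
  have "\<X> \<subseteq> projections M"
    using T_M UM by (auto simp: \<X>_def far_def)
  moreover have "pairwise (separated V e) \<X>"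
  proof (rule pairwiseI)
    fix P Q assume "P \<in> \<X>" "Q \<in> \<X>" "P \<noteq> Q"
    then consider W W' where "W \<in> \<W>" "W' \<in> \<W>" "W \<noteq> W'" "P = T W" "Q = T W'"
      | W where "W \<in> \<W>" "P = T W" "Q \<in> far" | W where "P \<in> far" "W \<in> \<W>" "Q = T W"
      | "P \<in> far" "Q \<in> far"
      unfolding \<X>_def by blast
    then show "separated V e P Q"
    proof cases
      case 4
      then show ?thesis
        using U(2) \<open>P \<noteq> Q\<close> by (simp add: far_def pairwise_def)
    qed (use T_T T_far far_T in auto)
  qed
  moreover have "controlled (V (2 * k)) P P" if "P \<in> \<X>" for P
    using that sat_controlled controlled_mono[OF d1 k(4) U(3)] by (auto simp: \<X>_def far_def)
  moreover have "\<exists>Q\<in>\<X>. Q o\<^sub>L P = P" if PUW: "P \<in> \<U> \<union> \<W>" for P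
  proof (cases "P \<in> far")
    case True
    then show ?thesis
      using is_projectionD(2)[OF UM(2)] by (auto simp: \<X>_def far_def)
  next
    case False
    then obtain W where "W \<in> \<W>" "P \<in> insert W (near W)"
      using PUW unfolding far_def near_def by blast
    then show ?thesis
      unfolding \<X>_def T_def using proj_join_absorbs[of P "insert W (near W)"] by blast
  qed
  ultimately show ?thesis
    unfolding k_def by blast
qed

text \<open>Families of equal index are merged, so their number stays \<open>n + 1\<close>. The
  second cover is chosen once \<open>d1\<close> is known, since its separation has to exceed the
  size of the first.\<close>

lemma asdim_le_of_covers:
  assumes join: "proj_join {R1, R2} = id_blinfun"
    and c1: "\<And>e. 0 < e \<Longrightarrow> \<exists>\<U> d. controlled_cover n e d \<U> R1"
    and c2: "\<And>e. 0 < e \<Longrightarrow> \<exists>\<U> d. controlled_cover n e d \<U> R2"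
  shows "asdim_le UNIV M V n"
  unfolding asdim_le_def
proof (intro allI impI)
  fix r :: real assume "0 < r"
  \<comment> \<open>Neighbourhoods of radius \<open>r\<close> are orthogonal once the projections
    are \<open>2 * r\<close>-separated.\<close>
  define e where "e = 2 * r"
  have e: "0 < e"
    using \<open>0 < r\<close> by (simp add: e_def)
  obtain \<U> d1 where d1: "0 \<le> d1" and U: "\<And>i. i \<le> n \<Longrightarrow> \<U> i \<subseteq> projections M"
      "\<And>i. i \<le> n \<Longrightarrow> pairwise (separated V e) (\<U> i)"
      "\<And>i P. i \<le> n \<Longrightarrow> P \<in> \<U> i \<Longrightarrow> controlled (V d1) P P"
    and U_join: "proj_join (\<Union>i\<le>n. \<U> i) = R1"
    using c1[OF e] unfolding controlled_cover_def by metis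
  have "0 < 2 * e + d1"
    using e d1 by simp
  then obtain \<W> d2 where d2: "0 \<le> d2" and W: "\<And>i. i \<le> n \<Longrightarrow> \<W> i \<subseteq> projections M"
      "\<And>i. i \<le> n \<Longrightarrow> pairwise (separated V (2 * e + d1)) (\<W> i)"
      "\<And>i P. i \<le> n \<Longrightarrow> P \<in> \<W> i \<Longrightarrow> controlled (V d2) P P"
    and W_join: "proj_join (\<Union>i\<le>n. \<W> i) = R2"
    using c2[of "2 * e + d1"] unfolding controlled_cover_def by metis
  define D where "D = 2 * (d1 + e + d2)"
  have D: "0 < D"
    using e d1 d2 by (simp add: D_def)
  have "\<exists>\<X>\<subseteq>projections M. pairwise (separated V e) \<X> \<and>
    (\<forall>P\<in>\<X>. controlled (V D) P P) \<and> (\<forall>P\<in>\<U> i \<union> \<W> i. \<exists>Q\<in>\<X>. Q o\<^sub>L P = P)" if "i \<le> n" for i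
    unfolding D_def by (rule saturated_union[OF e d1 d2 U[OF that] W[OF that]])
  then obtain \<X> where X: "\<And>i. i \<le> n \<Longrightarrow> \<X> i \<subseteq> projections M"
      "\<And>i. i \<le> n \<Longrightarrow> pairwise (separated V e) (\<X> i)"
      "\<And>i P. i \<le> n \<Longrightarrow> P \<in> \<X> i \<Longrightarrow> controlled (V D) P P"
      "\<And>i P. i \<le> n \<Longrightarrow> P \<in> \<U> i \<union> \<W> i \<Longrightarrow> \<exists>Q\<in>\<X> i. Q o\<^sub>L P = P"
    by metis
  have "uniformly_bounded_family UNIV M V (\<X> i)" if "i \<le> n" for i
    unfolding uniformly_bounded_family_def
    using D X(3)[OF that] by (intro exI[of _ D]) (auto intro!: SUP_least qdiam_le)
  moreover have "disjoint_family_at UNIV M V r (\<X> i)" if "i \<le> n" for i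
    unfolding disjoint_family_at_def
  proof (intro ballI impI qnbhd_compose_eq_0)
    fix P Q assume PQ: "P \<in> \<X> i" "Q \<in> \<X> i" "P \<noteq> Q"
    show "P \<in> projections M" "Q \<in> projections M"
      using PQ X(1)[OF that] by auto
    show "separated V (2 * r) P Q"
      using PQ X(2)[OF that] by (simp add: pairwise_def e_def)
  qed
  moreover have "is_cover UNIV (\<Union>i\<le>n. \<X> i)"
  proof -
    define J where "J = proj_join (\<Union>i\<le>n. \<X> i)"
    have "(id_blinfun - J) \<in> operators_on UNIV"
      unfolding J_def by (intro is_projectionD(1) is_projection_complement is_projection_proj_join)
    note vanish = compose_proj_join_eq_0[OF this]
    have J: "(id_blinfun - J) o\<^sub>L P = 0" if iP: "i \<le> n" "P \<in> \<U> i \<union> \<W> i" for i P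
    proof -
      obtain Q where Q: "Q \<in> \<X> i" "Q o\<^sub>L P = P"
        using X(4)[OF iP] by blast
      have "J o\<^sub>L Q = Q"
        unfolding J_def using iP(1) Q(1) by (intro proj_join_absorbs) auto
      then have "J o\<^sub>L P = P"
        by (metis Q(2) blinfun_compose_assoc)
      then show ?thesis
        by (simp add: blinfun_compose_diff_left)
    qed
    \<comment> \<open>The complement of \<open>J\<close> annihilates both members of each merged
      pair of families, hence \<open>R1\<close> and \<open>R2\<close>, hence their join, the
      identity.\<close>
    have "(id_blinfun - J) o\<^sub>L R1 = 0"
      unfolding U_join[symmetric] by (rule vanish) (use J in auto)
    moreover have "(id_blinfun - J) o\<^sub>L R2 = 0"
      unfolding W_join[symmetric] by (rule vanish) (use J in auto)
    ultimately have "(id_blinfun - J) o\<^sub>L proj_join {R1, R2} = 0"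
      by (intro vanish) auto
    then have "J = id_blinfun"
      by (simp add: join)
    then show ?thesis
      by (simp add: is_cover_def J_def proj_onto_UNIV)
  qed
  ultimately show "\<exists>\<P>. (\<forall>i\<le>n. \<P> i \<subseteq> projections M \<and> uniformly_bounded_family UNIV M V (\<P> i) \<and>
      disjoint_family_at UNIV M V r (\<P> i)) \<and> is_cover UNIV (\<Union>i\<le>n. \<P> i)"
    using X(1) by (intro exI[of _ \<X>]) simp
qed

end

section \<open>From covers to the value of \<open>asdim\<close>\<close>

lemma asdim_le_mono:
  fixes K :: "'a::complex_hilbert set"
  assumes m: "asdim_le K M V m" and "m \<le> n"
  shows "asdim_le K M V n"
  unfolding asdim_le_def
proof (intro allI impI)
  fix r :: real assume "0 < r"
  obtain \<P> :: "nat \<Rightarrow> ('a \<Rightarrow>\<^sub>L 'a) set" where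
    P: "\<forall>i\<le>m. \<P> i \<subseteq> projections M \<and> uniformly_bounded_family K M V (\<P> i) \<and>
      disjoint_family_at K M V r (\<P> i)"
    and cov: "is_cover K (\<Union>i\<le>m. \<P> i)"
    using m[unfolded asdim_le_def, rule_format, OF \<open>0 < r\<close>] by (elim exE conjE) (rule that)
  \<comment> \<open>Surplus indices receive empty families; these are uniformly bounded because an
    empty supremum in \<open>ereal\<close> is minus infinity.\<close>
  define \<P>' where "\<P>' i = (if i \<le> m then \<P> i else {})" for i
  have "(\<Union>i\<le>n. \<P>' i) = (\<Union>i\<le>m. \<P> i)"
    using \<open>m \<le> n\<close> by (intro equalityI) (fastforce simp: \<P>'_def split: if_splits)+
  moreover have "uniformly_bounded_family K M V {}" "disjoint_family_at K M V r {}"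
    by (auto simp: uniformly_bounded_family_def disjoint_family_at_def bot_ereal_def
        intro: exI[of _ 1])
  ultimately show "\<exists>\<P>. (\<forall>i\<le>n. \<P> i \<subseteq> projections M \<and> uniformly_bounded_family K M V (\<P> i) \<and>
      disjoint_family_at K M V r (\<P> i)) \<and> is_cover K (\<Union>i\<le>n. \<P> i)"
    using P cov by (intro exI[of _ \<P>']) (simp add: \<P>'_def)
qed

text \<open>A nonempty set of extended naturals contains its infimum, and the empty set has infimum
  \<infinity>. So a finite value is attained, and monotonicity in \<open>n\<close> does the
  rest.\<close>

lemma asdim_le_iff: "asdim K M V \<le> enat n \<longleftrightarrow> asdim_le K M V n"
proof
  assume le: "asdim K M V \<le> enat n"
  let ?S = "{enat n | n. asdim_le K M V n}"
  have "?S \<noteq> {}"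
  proof
    assume "?S = {}"
    then have "asdim K M V = \<infinity>"
      unfolding asdim_def by (simp only: Inf_empty top_enat_def)
    with le show False
      by simp
  qed
  then have "asdim K M V \<in> ?S"
    unfolding asdim_def Inf_enat_def by (auto intro: LeastI)
  then show "asdim_le K M V n"
    using le asdim_le_mono by fastforce
qed (auto simp: asdim_def intro: Inf_lower)

theorem theorem4p11:
  fixes M :: "('a::complex_hilbert \<Rightarrow>\<^sub>L 'a) set"
    and V :: "real \<Rightarrow> ('a \<Rightarrow>\<^sub>L 'a) set"
    and R1 R2 :: "'a \<Rightarrow>\<^sub>L 'a"
  assumes "von_neumann_algebra UNIV M"
    and "quantum_metric UNIV M V"
    and "reflexive_metric UNIV V"
    and "central_projection M R1"
    and "central_projection M R2"
    and "proj_join {R1, R2} = id_blinfun"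
  shows "asdim UNIV M V \<le>
    max (asdim (range R1) (quotient_algebra R1 M) (quotient_metric R1 V))
        (asdim (range R2) (quotient_algebra R2 M) (quotient_metric R2 V))"
proof -
  interpret Q1: metric_quotient M V R1
    using assms by unfold_locales
  interpret Q2: metric_quotient M V R2
    using assms by unfold_locales
  let ?m = "max (asdim (range R1) (quotient_algebra R1 M) (quotient_metric R1 V))
        (asdim (range R2) (quotient_algebra R2 M) (quotient_metric R2 V))"
  show ?thesis
  proof (cases ?m)
    \<comment> \<open>A finite maximum bounds both dimensions, so both quotients have covers by the
      same number \<open>n + 1\<close> of families.\<close>
    case (enat n)
    then have "asdim_le (range R1) (quotient_algebra R1 M) (quotient_metric R1 V) n"
      "asdim_le (range R2) (quotient_algebra R2 M) (quotient_metric R2 V) n"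
      unfolding asdim_le_iff[symmetric] by (metis max.cobounded1, metis max.cobounded2)
    then have "asdim_le UNIV M V n"
      by (intro Q1.asdim_le_of_covers[OF assms(6)] Q1.quotient_cover Q2.quotient_cover)
    then show ?thesis
      by (simp only: enat asdim_le_iff)
  qed simp
qed

end
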